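(* Let $n\ge2$ and let $\xi\in\mathcal F_n^2$ be a finite Blaschke symbol of degree $d\ge0$. Let $\mathcal A_\xi=C^*(S_1,\dots,S_n,W_\xi)\subseteq\mathcal B(\mathcal F_n^2)$, let $\pi$ be the Calkin quotient map of $\mathcal B(\mathcal F_n^2)$, let $\rho_\xi:\mathcal Q(O_n)\to\pi(\mathcal A_\xi)$ be the $*$-isomorphism with $\rho_\xi(u)=\pi(W_\xi)$ and $\rho_\xi(t_i)=\pi(S_i)$ for $1\le i\le n$, and put $\Phi_\xi:=\rho_\xi^{-1}\circ\pi|_{\mathcal A_\xi}$. Then there is a short exact sequence $$0\longrightarrow\mathcal K(\mathcal F_n^2)\longrightarrow\mathcal A_\xi\overset{\Phi_\xi}{\longrightarrow}\mathcal Q(O_n)\longrightarrow0,$$ (the first map being the inclusion), exhibiting $\mathcal A_\xi$ as an essential extension of $\mathcal Q(O_n)$ by the compact operators, i.e. $\mathcal K(\mathcal F_n^2)$ is an essential ideal of $\mathcal A_\xi$.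
   Context: Full Fock space: $\mathcal F_n^2=\mathbb C\Omega\oplus\bigoplus_{m\ge1}(\mathbb C^n)^{\otimes m}$, with canonical orthonormal basis $\{e_\mu:\mu\in\mathbb F_n^+\}$, where $\mathbb F_n^+$ is the free monoid on letters $1,\dots,n$ with identity $\varnothing$, $e_\varnothing=\Omega$, and $e_{\mu_1\cdots\mu_m}=e_{\mu_1}\otimes\cdots\otimes e_{\mu_m}$. The left creation operators are the isometries $S_ie_\mu=e_{i\mu}$, $1\le i\le n$. Scalar odometer map: for $\xi\in\mathcal F_n^2$, $W_\xi$ is the operator on $\mathcal F_n^2$ determined by $W_\xi\Omega=\xi$ and, for a nonempty word $\mu=\mu_1\cdots\mu_m$: if $\mu\ne n^m$ (not all letters equal $n$) and $r=\min\{j:\mu_j\neq n\}$, then $W_\xi e_\mu=e_1^{\otimes(r-1)}\otimes e_{\mu_r+1}\otimes e_{\mu_{r+1}}\otimes\cdots\otimes e_{\mu_m}$; if $\mu=n^m$, then $W_\xi e_{n^m}=e_1^{\otimes m}\otimes\xi=S_1^m\xi$. The vector $\xi$ is an isometric scalar symbol if $W_\xi$ is an isometry (i.e. this prescription extends to an isometry). Let $\mathcal M^\perp=\overline{\operatorname{span}}\{e_1^{\otimes p}:p\ge0\}$ (with $e_1^{\otimes 0}=\Omega$) and $U_1:\mathcal M^\perp\to H^2(\mathbb D)$ the unitary $U_1(e_1^{\otimes p})=z^p$. Known fact: $W_\xi$ is an isometry if and only if $\xi\in\mathcal M^\perp$ and $\Theta_\xi:=U_1\xi$ is inner. An isometric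 scalar symbol $\xi$ is a finite Blaschke symbol of degree $d\ge0$ if $\Theta_\xi(z)=\lambda\prod_{j=1}^d\frac{z-a_j}{1-\overline{a_j}z}$ with $\lambda\in\mathbb T$, $a_1,\dots,a_d\in\mathbb D$ (for $d=0$, a unimodular constant). Boundary quotient: $\mathcal Q(O_n)$ is the universal unital $C^*$-algebra generated by a unitary $u$ and isometries $t_1,\dots,t_n$ satisfying $t_i^*t_j=\delta_{ij}1$, $\sum_{i=1}^nt_it_i^*=1$, $ut_i=t_{i+1}$ for $1\le i<n$, and $ut_n=t_1u$. It is known that $\mathcal Q(O_n)$ is simple, nuclear and purely infinite. For a finite Blaschke symbol $\xi$, the isomorphism $\rho_\xi$ exists and is uniquely determined by its values on the generators. A closed ideal is essential if it has nonzero intersection with every nonzero closed two-sided ideal. *)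

theory Defs
  imports "HOL-Analysis.Analysis" "HOL-Algebra.Algebraic_Closure_Type"
begin

section \<open>\<open>C\<^sup>*\<close>-algebras\<close>

text \<open>
  Complex \<open>*\<close>-algebras with a norm are HOL-Algebra rings with explicit carrier, extended by a
  scalar multiplication, an involution and a norm.
\<close>

record 'a cstar = "(complex, 'a) module" +
  adj :: "'a \<Rightarrow> 'a"
  nrm :: "'a \<Rightarrow> real"

locale unital_cstar_algebra =
  module "ring_of_type_algebra :: complex ring" A + ring A
  for A :: "('a, 'm) cstar_scheme" (structure) +
  assumes smult_mult_left:
      "\<lbrakk>x \<in> carrier A; y \<in> carrier A\<rbrakk> \<Longrightarrow> (c \<odot> x) \<otimes> y = c \<odot> (x \<otimes> y)"
    and smult_mult_right:
      "\<lbrakk>x \<in> carrier A; y \<in> carrier A\<rbrakk> \<Longrightarrow> x \<otimes> (c \<odot> y) = c \<odot> (x \<otimes> y)"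
    and adj_closed: "x \<in> carrier A \<Longrightarrow> adj A x \<in> carrier A"
    and adj_adj: "x \<in> carrier A \<Longrightarrow> adj A (adj A x) = x"
    and adj_add:
      "\<lbrakk>x \<in> carrier A; y \<in> carrier A\<rbrakk> \<Longrightarrow> adj A (x \<oplus> y) = adj A x \<oplus> adj A y"
    and adj_smult: "x \<in> carrier A \<Longrightarrow> adj A (c \<odot> x) = cnj c \<odot> adj A x"
    and adj_mult:
      "\<lbrakk>x \<in> carrier A; y \<in> carrier A\<rbrakk> \<Longrightarrow> adj A (x \<otimes> y) = adj A y \<otimes> adj A x"
    and nrm_nonneg: "x \<in> carrier A \<Longrightarrow> 0 \<le> nrm A x"
    and nrm_eq_0_iff: "x \<in> carrier A \<Longrightarrow> nrm A x = 0 \<longleftrightarrow> x = \<zero>"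
    and nrm_triangle:
      "\<lbrakk>x \<in> carrier A; y \<in> carrier A\<rbrakk> \<Longrightarrow> nrm A (x \<oplus> y) \<le> nrm A x + nrm A y"
    and nrm_smult: "x \<in> carrier A \<Longrightarrow> nrm A (c \<odot> x) = cmod c * nrm A x"
    and nrm_mult:
      "\<lbrakk>x \<in> carrier A; y \<in> carrier A\<rbrakk> \<Longrightarrow> nrm A (x \<otimes> y) \<le> nrm A x * nrm A y"
    and cstar_identity: "x \<in> carrier A \<Longrightarrow> nrm A (adj A x \<otimes> x) = (nrm A x)\<^sup>2"
    and complete:
      "\<lbrakk>\<forall>k. s k \<in> carrier A;
        \<forall>\<epsilon>>0. \<exists>N. \<forall>k\<ge>N. \<forall>l\<ge>N. nrm A (s k \<ominus> s l) < \<epsilon>\<rbrakk>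
       \<Longrightarrow> \<exists>x\<in>carrier A. (\<lambda>k. nrm A (s k \<ominus> x)) \<longlonglongrightarrow> 0"

text \<open>Homomorphisms are not required to preserve units, so that non-unital algebras are covered.\<close>

definition star_hom ::
    "('a, 'm) cstar_scheme \<Rightarrow> ('b, 'k) cstar_scheme \<Rightarrow> ('a \<Rightarrow> 'b) \<Rightarrow> bool" where
  "star_hom A B \<phi> \<longleftrightarrow>
     \<phi> \<in> hom A B \<and> \<phi> \<in> hom (add_monoid A) (add_monoid B) \<and>
     (\<forall>c. \<forall>x\<in>carrier A. \<phi> (c \<odot>\<^bsub>A\<^esub> x) = c \<odot>\<^bsub>B\<^esub> \<phi> x) \<and>
     (\<forall>x\<in>carrier A. \<phi> (adj A x) = adj B (\<phi> x))"

definition star_iso ::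
    "('a, 'm) cstar_scheme \<Rightarrow> ('b, 'k) cstar_scheme \<Rightarrow> ('a \<Rightarrow> 'b) \<Rightarrow> bool" where
  "star_iso A B \<phi> \<longleftrightarrow> star_hom A B \<phi> \<and> bij_betw \<phi> (carrier A) (carrier B)"

definition norm_closed :: "'a set \<Rightarrow> ('a, 'm) cstar_scheme \<Rightarrow> bool" where
  "norm_closed H A \<longleftrightarrow>
     (\<forall>s. \<forall>x\<in>carrier A. (\<forall>k::nat. s k \<in> H) \<and> (\<lambda>k. nrm A (s k \<ominus>\<^bsub>A\<^esub> x)) \<longlonglongrightarrow> 0 \<longrightarrow> x \<in> H)"

definition cstar_subalgebra :: "'a set \<Rightarrow> ('a, 'm) cstar_scheme \<Rightarrow> bool" where
  "cstar_subalgebra H A \<longleftrightarrow>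
     H \<subseteq> carrier A \<and> \<zero>\<^bsub>A\<^esub> \<in> H \<and>
     (\<forall>x\<in>H. \<forall>y\<in>H. x \<oplus>\<^bsub>A\<^esub> y \<in> H \<and> x \<otimes>\<^bsub>A\<^esub> y \<in> H) \<and>
     (\<forall>c. \<forall>x\<in>H. c \<odot>\<^bsub>A\<^esub> x \<in> H) \<and>
     (\<forall>x\<in>H. adj A x \<in> H) \<and>
     norm_closed H A"

definition cstar_generated :: "('a, 'm) cstar_scheme \<Rightarrow> 'a set \<Rightarrow> 'a set" where
  "cstar_generated A G = \<Inter>{H. cstar_subalgebra H A \<and> G \<subseteq> H}"

text \<open>
  Ideals of HOL-Algebra are two-sided; in a unital algebra they are automatically closed under
  complex scalars.
\<close>

definition closed_ideal :: "'a set \<Rightarrow> ('a, 'm) cstar_scheme \<Rightarrow> bool" where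
  "closed_ideal I A \<longleftrightarrow> ideal I A \<and> norm_closed I A"

definition essential_ideal :: "'a set \<Rightarrow> ('a, 'm) cstar_scheme \<Rightarrow> bool" where
  "essential_ideal I A \<longleftrightarrow>
     closed_ideal I A \<and>
     (\<forall>J. closed_ideal J A \<and> J \<noteq> {\<zero>\<^bsub>A\<^esub>} \<longrightarrow> I \<inter> J \<noteq> {\<zero>\<^bsub>A\<^esub>})"

definition cstar_quot :: "('a, 'm) cstar_scheme \<Rightarrow> 'a set \<Rightarrow> 'a set cstar" where
  "cstar_quot A I =
     \<lparr>carrier = carrier (A Quot I), monoid.mult = (\<otimes>\<^bsub>A Quot I\<^esub>), one = \<one>\<^bsub>A Quot I\<^esub>,
      ring.zero = \<zero>\<^bsub>A Quot I\<^esub>, add = (\<oplus>\<^bsub>A Quot I\<^esub>),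
      smult = (\<lambda>c C. \<Union>x\<in>C. I +>\<^bsub>A\<^esub> (c \<odot>\<^bsub>A\<^esub> x)),
      adj = (\<lambda>C. \<Union>x\<in>C. I +>\<^bsub>A\<^esub> adj A x),
      nrm = (\<lambda>C. INF x\<in>C. nrm A x)\<rparr>"

text \<open>Exactness of \<open>0 \<rightarrow> I \<rightarrow> A \<rightarrow> Q \<rightarrow> 0\<close> in the category of \<open>C\<^sup>*\<close>-algebras.\<close>

definition short_exact ::
    "('a, 'm) cstar_scheme \<Rightarrow> ('a \<Rightarrow> 'b) \<Rightarrow> ('b, 'k) cstar_scheme \<Rightarrow> ('b \<Rightarrow> 'c)
      \<Rightarrow> ('c, 'l) cstar_scheme \<Rightarrow> bool" where
  "short_exact I \<iota> A \<phi> Q \<longleftrightarrow>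
     star_hom I A \<iota> \<and> star_hom A Q \<phi> \<and>
     inj_on \<iota> (carrier I) \<and>
     \<iota> ` carrier I = {x \<in> carrier A. \<phi> x = \<zero>\<^bsub>Q\<^esub>} \<and>
     \<phi> ` carrier A = carrier Q"

section \<open>The boundary quotient \<open>\<Q>(O\<^sub>n)\<close>\<close>

definition boundary_relations ::
    "nat \<Rightarrow> ('a, 'm) cstar_scheme \<Rightarrow> 'a \<Rightarrow> (nat \<Rightarrow> 'a) \<Rightarrow> bool" where
  "boundary_relations n A u t \<longleftrightarrow>
     u \<in> carrier A \<and> (\<forall>i\<in>{1..n}. t i \<in> carrier A) \<and>
     adj A u \<otimes>\<^bsub>A\<^esub> u = \<one>\<^bsub>A\<^esub> \<and> u \<otimes>\<^bsub>A\<^esub> adj A u = \<one>\<^bsub>A\<^esub> \<and>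
     (\<forall>i\<in>{1..n}. \<forall>j\<in>{1..n}. adj A (t i) \<otimes>\<^bsub>A\<^esub> t j = (if i = j then \<one>\<^bsub>A\<^esub> else \<zero>\<^bsub>A\<^esub>)) \<and>
     (\<Oplus>\<^bsub>A\<^esub>i\<in>{1..n}. t i \<otimes>\<^bsub>A\<^esub> adj A (t i)) = \<one>\<^bsub>A\<^esub> \<and>
     (\<forall>i\<in>{1..<n}. u \<otimes>\<^bsub>A\<^esub> t i = t (i + 1)) \<and>
     u \<otimes>\<^bsub>A\<^esub> t n = t 1 \<otimes>\<^bsub>A\<^esub> u"

text \<open>
  \<open>Q\<close>, together with \<open>u\<close> and \<open>t\<close>, is the universal unital \<open>C\<^sup>*\<close>-algebra for the relations above.
  The test algebras \<open>B\<close> have their carrier inside the type of real numbers. This is no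
  restriction: in an arbitrary unital \<open>C\<^sup>*\<close>-algebra the elements \<open>v\<close>, \<open>s\<^sub>1\<close>, ..., \<open>s\<^sub>n\<close>
  generate a separable one, which has at most the cardinality of the continuum. The
  homomorphism is unique because \<open>u\<close> and the \<open>t\<^sub>i\<close> generate \<open>Q\<close>.
\<close>

definition is_boundary_quotient ::
    "nat \<Rightarrow> 'q cstar \<Rightarrow> 'q \<Rightarrow> (nat \<Rightarrow> 'q) \<Rightarrow> bool" where
  "is_boundary_quotient n Q u t \<longleftrightarrow>
     unital_cstar_algebra Q \<and> boundary_relations n Q u t \<and>
     cstar_generated Q ({u} \<union> t ` {1..n}) = carrier Q \<and>
     (\<forall>(B :: real cstar) v s. unital_cstar_algebra B \<and> boundary_relations n B v s \<longrightarrow>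
        (\<exists>\<phi>. star_hom Q B \<phi> \<and> \<phi> \<one>\<^bsub>Q\<^esub> = \<one>\<^bsub>B\<^esub> \<and> \<phi> u = v \<and> (\<forall>i\<in>{1..n}. \<phi> (t i) = s i)))"

section \<open>Operators on the full Fock space\<close>

text \<open>
  A vector of the Fock space is its family of coordinates with respect to the basis \<open>e\<^sub>\<mu>\<close>,
  set to \<open>0\<close> on lists that are not words in the letters \<open>1\<close>, ..., \<open>n\<close>.
\<close>

type_synonym fvec = "nat list \<Rightarrow> complex"

definition fwords :: "nat \<Rightarrow> nat list set" where
  "fwords n = lists {1..n}"

definition fock :: "nat \<Rightarrow> fvec set" where
  "fock n = {f. (\<forall>\<mu>. \<mu> \<notin> fwords n \<longrightarrow> f \<mu> = 0) \<and> (\<lambda>\<mu>. (cmod (f \<mu>))\<^sup>2) summable_on UNIV}"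

definition fnorm :: "fvec \<Rightarrow> real" where
  "fnorm f = sqrt (\<Sum>\<^sub>\<infinity>\<mu>. (cmod (f \<mu>))\<^sup>2)"

definition finner :: "fvec \<Rightarrow> fvec \<Rightarrow> complex" where
  "finner f g = (\<Sum>\<^sub>\<infinity>\<mu>. f \<mu> * cnj (g \<mu>))"

definition fbasis :: "nat list \<Rightarrow> fvec" where
  "fbasis \<mu> = (\<lambda>\<nu>. if \<nu> = \<mu> then 1 else 0)"

definition bounded_ops :: "nat \<Rightarrow> (fvec \<Rightarrow> fvec) set" where
  "bounded_ops n = {T \<in> fock n \<rightarrow>\<^sub>E fock n.
     (\<forall>f\<in>fock n. \<forall>g\<in>fock n. T (\<lambda>\<mu>. f \<mu> + g \<mu>) = (\<lambda>\<mu>. T f \<mu> + T g \<mu>)) \<and>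
     (\<forall>c. \<forall>f\<in>fock n. T (\<lambda>\<mu>. c * f \<mu>) = (\<lambda>\<mu>. c * T f \<mu>)) \<and>
     (\<exists>C. \<forall>f\<in>fock n. fnorm (T f) \<le> C * fnorm f)}"

definition op_adj :: "nat \<Rightarrow> (fvec \<Rightarrow> fvec) \<Rightarrow> (fvec \<Rightarrow> fvec)" where
  "op_adj n T = (THE S. S \<in> bounded_ops n \<and>
     (\<forall>f\<in>fock n. \<forall>g\<in>fock n. finner (T f) g = finner f (S g)))"

definition op_norm :: "nat \<Rightarrow> (fvec \<Rightarrow> fvec) \<Rightarrow> real" where
  "op_norm n T = Sup {fnorm (T f) | f. f \<in> fock n \<and> fnorm f \<le> 1}"

definition op_algebra :: "nat \<Rightarrow> (fvec \<Rightarrow> fvec) cstar" where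
  "op_algebra n =
     \<lparr>carrier = bounded_ops n,
      monoid.mult = (\<lambda>S T. compose (fock n) S T),
      one = (\<lambda>f\<in>fock n. f),
      ring.zero = (\<lambda>f\<in>fock n. (\<lambda>\<mu>. 0)),
      add = (\<lambda>S T. \<lambda>f\<in>fock n. (\<lambda>\<mu>. S f \<mu> + T f \<mu>)),
      smult = (\<lambda>c T. \<lambda>f\<in>fock n. (\<lambda>\<mu>. c * T f \<mu>)),
      adj = op_adj n,
      nrm = op_norm n\<rparr>"

definition compact_ops :: "nat \<Rightarrow> (fvec \<Rightarrow> fvec) set" where
  "compact_ops n = {T \<in> bounded_ops n.
     \<forall>s. (\<forall>k::nat. s k \<in> fock n \<and> fnorm (s k) \<le> 1) \<longrightarrow>
       (\<exists>g\<in>fock n. \<exists>r. strict_mono r \<and> (\<lambda>k. fnorm (\<lambda>\<mu>. T (s (r k)) \<mu> - g \<mu>)) \<longlonglongrightarrow> 0)}"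

definition calkin_algebra :: "nat \<Rightarrow> (fvec \<Rightarrow> fvec) set cstar" where
  "calkin_algebra n = cstar_quot (op_algebra n) (compact_ops n)"

definition calkin_map :: "nat \<Rightarrow> (fvec \<Rightarrow> fvec) \<Rightarrow> (fvec \<Rightarrow> fvec) set" where
  "calkin_map n T = compact_ops n +>\<^bsub>op_algebra n\<^esub> T"

text \<open>The unique bounded operator with prescribed values on the canonical basis, if there is one.\<close>

definition op_on_basis :: "nat \<Rightarrow> (nat list \<Rightarrow> fvec) \<Rightarrow> (fvec \<Rightarrow> fvec)" where
  "op_on_basis n v = (THE T. T \<in> bounded_ops n \<and> (\<forall>\<mu>\<in>fwords n. T (fbasis \<mu>) = v \<mu>))"

definition creation :: "nat \<Rightarrow> nat \<Rightarrow> (fvec \<Rightarrow> fvec)" where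
  "creation n i = op_on_basis n (\<lambda>\<mu>. fbasis (i # \<mu>))"

section \<open>Scalar odometer maps\<close>

text \<open>
  The number \<open>r\<close> of leading letters \<open>n\<close> is the position of the first letter different from \<open>n\<close>,
  with positions counted from \<open>0\<close>. The case of words without such a letter includes the empty
  word, whose image is \<open>\<xi>\<close>.
\<close>

definition odometer_value :: "nat \<Rightarrow> fvec \<Rightarrow> nat list \<Rightarrow> fvec" where
  "odometer_value n \<xi> \<mu> =
     (if \<forall>j\<in>set \<mu>. j = n then (creation n 1 ^^ length \<mu>) \<xi>
      else let r = length (takeWhile (\<lambda>j. j = n) \<mu>)
           in fbasis (replicate r 1 @ (\<mu> ! r + 1) # drop (r + 1) \<mu>))"

definition odometer :: "nat \<Rightarrow> fvec \<Rightarrow> (fvec \<Rightarrow> fvec)" where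
  "odometer n \<xi> = op_on_basis n (odometer_value n \<xi>)"

definition isometric_scalar_symbol :: "nat \<Rightarrow> fvec \<Rightarrow> bool" where
  "isometric_scalar_symbol n \<xi> \<longleftrightarrow>
     \<xi> \<in> fock n \<and>
     (\<exists>V\<in>bounded_ops n. (\<forall>f\<in>fock n. fnorm (V f) = fnorm f) \<and>
        (\<forall>\<mu>\<in>fwords n. V (fbasis \<mu>) = odometer_value n \<xi> \<mu>))"

definition M_perp :: "nat \<Rightarrow> fvec set" where
  "M_perp n = {f \<in> fock n. \<forall>\<epsilon>>0. \<exists>N c.
     fnorm (\<lambda>\<mu>. f \<mu> - (\<Sum>p<N. c p * fbasis (replicate p 1) \<mu>)) < \<epsilon>}"

text \<open>
  The unitary from \<^term>\<open>M_perp n\<close> onto the Hardy space, whose elements are regarded as analytic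
  functions on the unit disc: \<open>e\<^sub>1\<^sup>p\<close> is mapped to \<open>z\<^sup>p\<close>.
\<close>

definition U1 :: "fvec \<Rightarrow> complex \<Rightarrow> complex" where
  "U1 f z = suminf (\<lambda>p. f (replicate p 1) * z ^ p)"

definition finite_Blaschke_symbol :: "nat \<Rightarrow> nat \<Rightarrow> fvec \<Rightarrow> bool" where
  "finite_Blaschke_symbol n d \<xi> \<longleftrightarrow>
     isometric_scalar_symbol n \<xi> \<and> \<xi> \<in> M_perp n \<and>
     (\<exists>c a. cmod c = 1 \<and> (\<forall>j\<in>{1..d}. cmod (a j) < 1) \<and>
        (\<forall>z\<in>ball 0 1. U1 \<xi> z = c * (\<Prod>j=1..d. (z - a j) / (1 - cnj (a j) * z))))"

definition odometer_algebra :: "nat \<Rightarrow> fvec \<Rightarrow> (fvec \<Rightarrow> fvec) cstar" where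
  "odometer_algebra n \<xi> = (op_algebra n)\<lparr>carrier :=
     cstar_generated (op_algebra n) (creation n ` {1..n} \<union> {odometer n \<xi>})\<rparr>"

definition calkin_image :: "nat \<Rightarrow> fvec \<Rightarrow> (fvec \<Rightarrow> fvec) set cstar" where
  "calkin_image n \<xi> =
     (calkin_algebra n)\<lparr>carrier := calkin_map n ` carrier (odometer_algebra n \<xi>)\<rparr>"

definition symbol_map ::
    "nat \<Rightarrow> fvec \<Rightarrow> 'q cstar \<Rightarrow> ('q \<Rightarrow> (fvec \<Rightarrow> fvec) set) \<Rightarrow> (fvec \<Rightarrow> fvec) \<Rightarrow> 'q" where
  "symbol_map n \<xi> Q \<rho> =
     (\<lambda>T\<in>carrier (odometer_algebra n \<xi>). inv_into (carrier Q) \<rho> (calkin_map n T))"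

end

theory Submission
  imports Defs
begin

text \<open>
  The vacuum projection is \<open>1 - \<Sum> S\<^sub>i S\<^sub>i\<^sup>*\<close>, and multiplying it by words in the \<open>S\<^sub>i\<close> on the left
  and in the \<open>S\<^sub>i\<^sup>*\<close> on the right yields all matrix units. Hence the creation operators alone already
  generate every compact operator, whatever the symbol. The kernel of \<open>\<Phi>\<^sub>\<xi>\<close> is therefore
  the whole algebra of compact operators, and a nonzero ideal \<open>J\<close> meets it because
  \<open>e\<^sub>\<mu> e\<^sub>\<mu>\<^sup>* T\<close> is a nonzero compact element of \<open>J\<close> whenever \<open>T \<in> J\<close> has a nonzero coordinate \<open>\<mu>\<close>.
\<close>

section \<open>The Fock space as a Hilbert space\<close>

text \<open>Since \<rho> is bijective, \<Phi> kills exactly those operators of the algebra that the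
  Calkin map kills, that is, the compact ones lying in it. Only the containment of all compact
  operators in the algebra turns this intersection into the full ideal. Matrix units span just the
  finite-rank operators supported on finitely many words, so this containment needs approximation in
  operator norm. It comes from the fact that a compact \<open>T\<close> is the norm limit of its
  compositions with the projections onto words of length at most \<open>N\<close>, which in turn
  rests on compact operators sending weakly null sequences to norm null ones. Adjoints and operators
  with given basis values are definite descriptions, and the operator norm is a real
  \<open>Sup\<close>; each has to be shown to denote before it can be used. Fock vectors are plain
  coordinate families, so the recurring device is an estimate over finite sets of words, uniform in
  the set, from which membership in the Fock space and the norm bound follow together.\<close>

lemma fock_support: "f \<in> fock n \<Longrightarrow> \<mu> \<notin> fwords n \<Longrightarrow> f \<mu> = 0"
  by (simp add: fock_def)

lemma fock_summable: "f \<in> fock n \<Longrightarrow> (\<lambda>\<mu>. (cmod (f \<mu>))\<^sup>2) summable_on UNIV"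
  by (simp add: fock_def)

lemma fnorm_nonneg [simp]: "0 \<le> fnorm f"
  by (simp add: fnorm_def infsum_nonneg)

lemma fnorm_power2: "(fnorm f)\<^sup>2 = (\<Sum>\<^sub>\<infinity>\<mu>. (cmod (f \<mu>))\<^sup>2)"
  by (simp add: fnorm_def infsum_nonneg)

lemma L2_set_le_fnorm:
  assumes "f \<in> fock n" and "finite F"
  shows "L2_set (\<lambda>\<mu>. cmod (f \<mu>)) F \<le> fnorm f"
  unfolding L2_set_def fnorm_def
  by (intro real_sqrt_le_mono finite_sum_le_infsum fock_summable[OF assms(1)]) (use assms in auto)

text \<open>Square sums over finite sets with a common upper bound are summable with the same bound.
  This is the device by which a coordinate formula is shown to be a Fock vector and its norm is
  estimated at once.\<close>

lemma fock_boundedI: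
  assumes supp: "\<And>\<mu>. \<mu> \<notin> fwords n \<Longrightarrow> f \<mu> = 0"
    and bound: "\<And>F. finite F \<Longrightarrow> L2_set (\<lambda>\<mu>. cmod (f \<mu>)) F \<le> c"
  shows "f \<in> fock n" and "fnorm f \<le> c"
proof -
  \<comment> \<open>The empty set of words forces \<open>c\<close> to be nonnegative, so that the
    bound may be squared.\<close>
  have c: "0 \<le> c"
    using bound[of "{}"] by simp
  have le: "(\<Sum>\<mu>\<in>F. (cmod (f \<mu>))\<^sup>2) \<le> c\<^sup>2" if "finite F" for F
    using bound[OF that] c unfolding L2_set_def by (simp add: real_sqrt_le_iff' sqrt_le_D)
  have sm: "(\<lambda>\<mu>. (cmod (f \<mu>))\<^sup>2) summable_on UNIV"
    by (rule nonneg_bdd_above_summable_on) (auto intro!: bdd_aboveI[where M="c\<^sup>2"] le)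
  then show "f \<in> fock n"
    using supp by (simp add: fock_def)
  have "(\<Sum>\<^sub>\<infinity>\<mu>. (cmod (f \<mu>))\<^sup>2) \<le> c\<^sup>2"
    by (rule infsum_le_finite_sums[OF sm le])
  then show "fnorm f \<le> c"
    unfolding fnorm_def using c by (simp add: real_le_lsqrt infsum_nonneg)
qed

text \<open>Minkowski's inequality on finite sets of words, with a right-hand side that does not
  depend on the set.\<close>

lemma fock_add:
  assumes "f \<in> fock n" "g \<in> fock n"
  shows "(\<lambda>\<mu>. f \<mu> + g \<mu>) \<in> fock n" and "fnorm (\<lambda>\<mu>. f \<mu> + g \<mu>) \<le> fnorm f + fnorm g"
proof -
  have "L2_set (\<lambda>\<mu>. cmod (f \<mu> + g \<mu>)) F \<le> fnorm f + fnorm g" if "finite F" for F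
  proof -
    have "L2_set (\<lambda>\<mu>. cmod (f \<mu> + g \<mu>)) F \<le> L2_set (\<lambda>\<mu>. cmod (f \<mu>) + cmod (g \<mu>)) F"
      by (intro L2_set_mono norm_triangle_ineq) auto
    also have "\<dots> \<le> L2_set (\<lambda>\<mu>. cmod (f \<mu>)) F + L2_set (\<lambda>\<mu>. cmod (g \<mu>)) F"
      by (rule L2_set_triangle_ineq)
    also have "\<dots> \<le> fnorm f + fnorm g"
      using assms that by (intro add_mono L2_set_le_fnorm)
    finally show ?thesis .
  qed
  then show "(\<lambda>\<mu>. f \<mu> + g \<mu>) \<in> fock n" "fnorm (\<lambda>\<mu>. f \<mu> + g \<mu>) \<le> fnorm f + fnorm g"
    by (intro fock_boundedI[of n]; use assms in \<open>auto simp: fock_support\<close>)+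
qed

lemma fnorm_scale: "fnorm (\<lambda>\<mu>. c * f \<mu>) = cmod c * fnorm f"
proof -
  have "(\<Sum>\<^sub>\<infinity>\<mu>. (cmod (c * f \<mu>))\<^sup>2) = (cmod c)\<^sup>2 * (\<Sum>\<^sub>\<infinity>\<mu>. (cmod (f \<mu>))\<^sup>2)"
    by (simp add: norm_mult power_mult_distrib infsum_cmult_right')
  then show ?thesis
    by (simp add: fnorm_def real_sqrt_mult)
qed

lemma fock_scale:
  assumes "f \<in> fock n"
  shows "(\<lambda>\<mu>. c * f \<mu>) \<in> fock n"
  using assms by (simp add: fock_def norm_mult power_mult_distrib summable_on_cmult_right)

lemma fock_zero [simp]: "(\<lambda>\<mu>. 0) \<in> fock n" and fnorm_zero [simp]: "fnorm (\<lambda>\<mu>. 0) = 0"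
  by (simp_all add: fock_def fnorm_def)

lemma fock_minus: "f \<in> fock n \<Longrightarrow> (\<lambda>\<mu>. - f \<mu>) \<in> fock n"
  using fock_scale[of f n "-1"] by simp

lemma fock_diff: "f \<in> fock n \<Longrightarrow> g \<in> fock n \<Longrightarrow> (\<lambda>\<mu>. f \<mu> - g \<mu>) \<in> fock n"
  using fock_add(1)[OF _ fock_minus, of f n g] by simp

lemma fnorm_minus: "fnorm (\<lambda>\<mu>. - f \<mu>) = fnorm f"
  using fnorm_scale[of "-1" f] by simp

lemma fnorm_minus_commute: "fnorm (\<lambda>\<mu>. f \<mu> - g \<mu>) = fnorm (\<lambda>\<mu>. g \<mu> - f \<mu>)"
  using fnorm_minus[of "\<lambda>\<mu>. f \<mu> - g \<mu>"] by simp

lemma fnorm_diff: "f \<in> fock n \<Longrightarrow> g \<in> fock n \<Longrightarrow> fnorm (\<lambda>\<mu>. f \<mu> - g \<mu>) \<le> fnorm f + fnorm g"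
  using fock_add(2)[OF _ fock_minus, of f n g] by (simp add: fnorm_minus)

lemma cmod_le_fnorm: "f \<in> fock n \<Longrightarrow> cmod (f \<mu>) \<le> fnorm f"
  using L2_set_le_fnorm[of f n "{\<mu>}"] by simp

lemma fnorm_eq_0: "f \<in> fock n \<Longrightarrow> fnorm f \<le> 0 \<Longrightarrow> f = (\<lambda>\<mu>. 0)"
  using cmod_le_fnorm[of f n] by (intro ext) (force dest: order_trans)

lemma fock_basis:
  assumes "\<mu> \<in> fwords n"
  shows "fbasis \<mu> \<in> fock n"
proof (rule fock_boundedI(1))
  fix F :: "nat list set"
  assume F: "finite F"
  have "(\<Sum>\<nu>\<in>F. (cmod (fbasis \<mu> \<nu>))\<^sup>2) = (\<Sum>\<nu>\<in>F. if \<nu> = \<mu> then 1 else 0)"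
    by (intro sum.cong) (auto simp: fbasis_def)
  then show "L2_set (\<lambda>\<nu>. cmod (fbasis \<mu> \<nu>)) F \<le> 1"
    using F by (simp add: L2_set_def sum.delta)
qed (use assms in \<open>auto simp: fbasis_def\<close>)

section \<open>The inner product\<close>

lemma finner_abs_summable:
  assumes "f \<in> fock n" "g \<in> fock n"
  shows "(\<lambda>\<mu>. norm (f \<mu> * cnj (g \<mu>))) summable_on UNIV" and "cmod (finner f g) \<le> fnorm f * fnorm g"
proof -
  \<comment> \<open>Cauchy-Schwarz on finite sets. It has to give absolute summability as well as
    the bound, because \<open>infsum\<close> takes the default value 0 on families that are not
    summable.\<close>
  have le: "(\<Sum>\<mu>\<in>F. norm (f \<mu> * cnj (g \<mu>))) \<le> fnorm f * fnorm g" if "finite F" for F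
  proof -
    have "(\<Sum>\<mu>\<in>F. norm (f \<mu> * cnj (g \<mu>))) \<le> L2_set (\<lambda>\<mu>. cmod (f \<mu>)) F * L2_set (\<lambda>\<mu>. cmod (g \<mu>)) F"
      using L2_set_mult_ineq[of "\<lambda>\<mu>. cmod (f \<mu>)" "\<lambda>\<mu>. cmod (g \<mu>)" F] by (simp add: norm_mult)
    also have "\<dots> \<le> fnorm f * fnorm g"
      using assms that by (intro mult_mono L2_set_le_fnorm) auto
    finally show ?thesis .
  qed
  show *: "(\<lambda>\<mu>. norm (f \<mu> * cnj (g \<mu>))) summable_on UNIV"
    by (rule nonneg_bdd_above_summable_on) (auto intro!: bdd_aboveI[where M="fnorm f * fnorm g"] le)
  have "cmod (finner f g) \<le> (\<Sum>\<^sub>\<infinity>\<mu>. norm (f \<mu> * cnj (g \<mu>)))"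
    unfolding finner_def by (rule norm_infsum_bound[OF *])
  also have "\<dots> \<le> fnorm f * fnorm g"
    by (rule infsum_le_finite_sums[OF * le])
  finally show "cmod (finner f g) \<le> fnorm f * fnorm g" .
qed

lemma finner_summable:
  "f \<in> fock n \<Longrightarrow> g \<in> fock n \<Longrightarrow> (\<lambda>\<mu>. f \<mu> * cnj (g \<mu>)) summable_on UNIV"
  by (rule abs_summable_summable[OF finner_abs_summable(1)])

lemma finner_self: "f \<in> fock n \<Longrightarrow> finner f f = of_real ((fnorm f)\<^sup>2)"
  unfolding finner_def fnorm_power2
  using has_sum_of_real[OF has_sum_infsum[OF fock_summable, of f n], where 'a=complex]
  by (intro infsumI) (simp add: complex_norm_square del: of_real_power)

lemma finner_commute: "finner f g = cnj (finner g f)"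
  unfolding finner_def by (simp flip: infsum_cnj add: mult.commute)

lemma finner_add_left:
  assumes "f \<in> fock n" "g \<in> fock n" "h \<in> fock n"
  shows "finner (\<lambda>\<mu>. f \<mu> + g \<mu>) h = finner f h + finner g h"
  unfolding finner_def using finner_summable[OF assms(1,3)] finner_summable[OF assms(2,3)]
  by (simp add: distrib_right infsum_add)

lemma finner_scale_left: "finner (\<lambda>\<mu>. c * f \<mu>) h = c * finner f h"
  unfolding finner_def by (simp add: infsum_cmult_right' mult.assoc)

lemma finner_add_right:
  assumes "f \<in> fock n" "g \<in> fock n" "h \<in> fock n"
  shows "finner h (\<lambda>\<mu>. f \<mu> + g \<mu>) = finner h f + finner h g"
  using finner_add_left[OF assms] by (metis complex_cnj_add finner_commute)

lemma finner_diff_left: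
  assumes "f \<in> fock n" "g \<in> fock n" "h \<in> fock n"
  shows "finner (\<lambda>\<mu>. f \<mu> - g \<mu>) h = finner f h - finner g h"
  using finner_add_left[OF assms(1) fock_minus[OF assms(2)] assms(3)] finner_scale_left[of "-1" g h]
  by simp

lemma finner_diff_right:
  assumes "f \<in> fock n" "g \<in> fock n" "h \<in> fock n"
  shows "finner h (\<lambda>\<mu>. f \<mu> - g \<mu>) = finner h f - finner h g"
  using finner_diff_left[OF assms] by (metis complex_cnj_diff finner_commute)

lemma finner_finite:
  assumes "finite F" "\<And>\<mu>. \<mu> \<notin> F \<Longrightarrow> f \<mu> = 0"
  shows "finner f g = (\<Sum>\<mu>\<in>F. f \<mu> * cnj (g \<mu>))"
proof -
  have "finner f g = infsum (\<lambda>\<mu>. f \<mu> * cnj (g \<mu>)) F"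
    unfolding finner_def by (rule infsum_cong_neutral) (use assms in auto)
  then show ?thesis
    using assms(1) by simp
qed

lemma finner_basis_right: "finner f (fbasis \<mu>) = f \<mu>"
  using finner_finite[of "{\<mu>}" "fbasis \<mu>" f] finner_commute[of f "fbasis \<mu>"]
  by (simp add: fbasis_def)

section \<open>Coordinate truncations and weakly null sequences\<close>

definition ftruncate :: "nat list set \<Rightarrow> fvec \<Rightarrow> fvec" where
  "ftruncate F f = (\<lambda>\<mu>. if \<mu> \<in> F then f \<mu> else 0)"

text \<open>The alphabet is finite, so these sets are finite, and they increase to all words. They
  replace the net of finite sets of words by a sequence, the form of limit used in
  \<open>norm_closed\<close> and in \<open>compact_ops\<close>.\<close>

definition short_words :: "nat \<Rightarrow> nat \<Rightarrow> nat list set" where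
  "short_words n N = {\<mu> \<in> fwords n. length \<mu> \<le> N}"

lemma finite_short_words: "finite (short_words n N)"
  unfolding short_words_def fwords_def lists_eq_set
  using finite_lists_length_le[of "{1..n}" N] by simp

lemma fock_ftruncate:
  assumes "f \<in> fock n"
  shows "ftruncate F f \<in> fock n" and "fnorm (ftruncate F f) \<le> fnorm f"
proof -
  have "L2_set (\<lambda>\<mu>. cmod (ftruncate F f \<mu>)) G \<le> fnorm f" if "finite G" for G
    using L2_set_mono[of G "\<lambda>\<mu>. cmod (ftruncate F f \<mu>)" "\<lambda>\<mu>. cmod (f \<mu>)"]
      L2_set_le_fnorm[OF assms that] by (force simp: ftruncate_def)
  then show "ftruncate F f \<in> fock n" "fnorm (ftruncate F f) \<le> fnorm f"
    by (intro fock_boundedI[of n]; use assms in \<open>auto simp: fock_support ftruncate_def\<close>)+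
qed

lemma tail_eq: "(\<lambda>\<mu>. f \<mu> - ftruncate F f \<mu>) = ftruncate (- F) f"
  by (auto simp: ftruncate_def)

text \<open>The squared norm of a tail is the squared norm of \<open>f\<close> minus a finite
  partial sum, and these partial sums converge along the cofinal sequence
  \<open>short_words n\<close>.\<close>

lemma fnorm_ftruncate_tendsto:
  assumes f: "f \<in> fock n"
  shows "(\<lambda>N. fnorm (\<lambda>\<mu>. f \<mu> - ftruncate (short_words n N) f \<mu>)) \<longlonglongrightarrow> 0"
proof -
  let ?q = "\<lambda>\<mu>. (cmod (f \<mu>))\<^sup>2"
  have lim: "(sum ?q \<longlongrightarrow> (fnorm f)\<^sup>2) (finite_subsets_at_top (fwords n))"
  proof -
    have "(?q has_sum (fnorm f)\<^sup>2) UNIV"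
      unfolding fnorm_power2 using fock_summable[OF f] by simp
    then have "(?q has_sum (fnorm f)\<^sup>2) (fwords n)"
      by (rule has_sum_cong_neutral[THEN iffD1, rotated -1]) (use fock_support[OF f] in auto)
    then show ?thesis
      by (simp add: has_sum_def)
  qed
  have "filterlim (short_words n) (finite_subsets_at_top (fwords n)) sequentially"
    unfolding filterlim_def le_filter_def eventually_filtermap
  proof safe
    fix P assume "eventually P (finite_subsets_at_top (fwords n))"
    then obtain F where F: "finite F" "F \<subseteq> fwords n"
      and P: "\<And>G. finite G \<Longrightarrow> F \<subseteq> G \<Longrightarrow> G \<subseteq> fwords n \<Longrightarrow> P G"
      by (auto simp: eventually_finite_subsets_at_top)
    \<comment> \<open>A finite set of words is absorbed once \<open>N\<close> reaches its largest
      length; inserting 0 provides a maximum when the set is empty.\<close>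
    have "P (short_words n N)" if "Max (insert 0 (length ` F)) \<le> N" for N
    proof (rule P[OF finite_short_words])
      show "F \<subseteq> short_words n N"
        using F that by (auto simp: short_words_def subset_iff)
    qed (auto simp: short_words_def)
    then show "\<forall>\<^sub>F N in sequentially. P (short_words n N)"
      by (auto simp: eventually_sequentially)
  qed
  from filterlim_compose[OF lim this]
  have lim2: "(\<lambda>N. (fnorm f)\<^sup>2 - sum ?q (short_words n N)) \<longlonglongrightarrow> 0"
    by (auto intro!: tendsto_eq_intros)
  have eq: "fnorm (\<lambda>\<mu>. f \<mu> - ftruncate F f \<mu>) = sqrt ((fnorm f)\<^sup>2 - sum ?q F)"
    if "finite F" for F
  proof -
    have "(\<Sum>\<^sub>\<infinity>\<mu>. (cmod (f \<mu> - ftruncate F f \<mu>))\<^sup>2) = infsum ?q (UNIV - F)"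
      by (rule infsum_cong_neutral) (auto simp: ftruncate_def)
    also have "\<dots> = (fnorm f)\<^sup>2 - sum ?q F"
      unfolding fnorm_power2
      using infsum_Diff[OF fock_summable[OF f] summable_on_finite[OF that]] that
      by simp
    finally show ?thesis
      by (simp add: fnorm_def[of "\<lambda>\<mu>. f \<mu> - ftruncate F f \<mu>"])
  qed
  show ?thesis
    using tendsto_real_sqrt[OF lim2] by (simp add: eq finite_short_words)
qed

text \<open>Weakly null sequences: for bounded sequences it is enough to test against the basis, and
  this form avoids quantifying over all vectors.\<close>

definition fnull :: "nat \<Rightarrow> (nat \<Rightarrow> fvec) \<Rightarrow> bool" where
  "fnull n s \<longleftrightarrow> (\<forall>k. s k \<in> fock n) \<and> (\<exists>M. \<forall>k. fnorm (s k) \<le> M) \<and> (\<forall>\<mu>. (\<lambda>k. s k \<mu>) \<longlonglongrightarrow> 0)"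

text \<open>Split \<open>g\<close> into a truncation and a tail. The pairing with the truncation is
  a finite sum of coordinates that tend to 0; the pairing with the tail is small uniformly in
  \<open>k\<close> because the sequence is bounded.\<close>

lemma fnull_finner:
  assumes s: "fnull n s" and g: "g \<in> fock n"
  shows "(\<lambda>k. finner (s k) g) \<longlonglongrightarrow> 0"
proof (rule LIMSEQ_I)
  fix e :: real assume e: "0 < e"
  from s obtain M where sf: "\<And>k. s k \<in> fock n" and M: "\<And>k. fnorm (s k) \<le> M"
    and s0: "\<And>\<mu>. (\<lambda>k. s k \<mu>) \<longlonglongrightarrow> 0"
    by (auto simp: fnull_def)
  have M0: "0 \<le> M"
    using M[of 0] fnorm_nonneg[of "s 0"] by linarith
  \<comment> \<open>Using \<open>M + 1\<close> instead of \<open>M\<close> keeps the denominator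
    positive when \<open>M\<close> is 0.\<close>
  have "\<forall>\<^sub>F N in sequentially. fnorm (\<lambda>\<mu>. g \<mu> - ftruncate (short_words n N) g \<mu>) < e / (2 * (M + 1))"
    using order_tendstoD(2)[OF fnorm_ftruncate_tendsto[OF g]] e M0 by simp
  then obtain N where N: "fnorm (\<lambda>\<mu>. g \<mu> - ftruncate (short_words n N) g \<mu>) < e / (2 * (M + 1))"
    by (auto simp: eventually_sequentially)
  let ?g = "ftruncate (short_words n N) g"
  have gf: "?g \<in> fock n"
    by (rule fock_ftruncate[OF g])
  have "finner (s k) ?g = (\<Sum>\<mu>\<in>short_words n N. s k \<mu> * cnj (g \<mu>))" for k
    using finner_finite[OF finite_short_words, of n N ?g "s k"] finner_commute[of "s k" ?g]
    by (simp add: ftruncate_def mult.commute)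
  moreover have "(\<lambda>k. \<Sum>\<mu>\<in>short_words n N. s k \<mu> * cnj (g \<mu>)) \<longlonglongrightarrow> (\<Sum>\<mu>\<in>short_words n N. 0 * cnj (g \<mu>))"
    by (intro tendsto_intros s0)
  ultimately have "(\<lambda>k. finner (s k) ?g) \<longlonglongrightarrow> 0"
    by simp
  from LIMSEQ_D[OF this, of "e/2"] e obtain K where K: "\<And>k. k \<ge> K \<Longrightarrow> cmod (finner (s k) ?g) < e/2"
    by auto
  have "cmod (finner (s k) g) < e" if "k \<ge> K" for k
  proof -
    have "finner (s k) g = finner (s k) ?g + finner (s k) (\<lambda>\<mu>. g \<mu> - ?g \<mu>)"
      using finner_diff_right[OF g gf sf[of k]] by simp
    then have "cmod (finner (s k) g) \<le> cmod (finner (s k) ?g) + cmod (finner (s k) (\<lambda>\<mu>. g \<mu> - ?g \<mu>))"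
      by (simp add: norm_triangle_ineq)
    also have "cmod (finner (s k) (\<lambda>\<mu>. g \<mu> - ?g \<mu>)) \<le> M * (e / (2 * (M + 1)))"
    proof -
      have "cmod (finner (s k) (\<lambda>\<mu>. g \<mu> - ?g \<mu>)) \<le> fnorm (s k) * fnorm (\<lambda>\<mu>. g \<mu> - ?g \<mu>)"
        by (rule finner_abs_summable(2)[OF sf fock_diff[OF g gf]])
      also have "\<dots> \<le> M * (e / (2 * (M + 1)))"
        using M[of k] N M0 by (intro mult_mono) auto
      finally show ?thesis .
    qed
    also have "M * (e / (2 * (M + 1))) \<le> e / 2"
      using M0 e by (simp add: field_simps)
    finally show ?thesis
      using K[OF that] by linarith
  qed
  then show "\<exists>K. \<forall>k\<ge>K. norm (finner (s k) g - 0) < e"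
    by auto
qed

text \<open>Coordinatewise boundedness and Tychonoff's theorem on the countable product.\<close>

lemma bounded_fock_subsequence:
  fixes s :: "nat \<Rightarrow> fvec"
  assumes sf: "\<And>k. s k \<in> fock n" and M: "\<And>k. fnorm (s k) \<le> M"
  obtains r f where "strict_mono r" "f \<in> fock n" "fnull n (\<lambda>k \<mu>. s (r k) \<mu> - f \<mu>)"
proof -
  have "compactin (product_topology (\<lambda>_. euclidean) UNIV) (\<Pi>\<^sub>E _\<in>(UNIV :: nat list set). cball (0::complex) M)"
    unfolding compactin_PiE by simp
  then have "seq_compact (\<Pi>\<^sub>E _\<in>(UNIV :: nat list set). cball (0::complex) M)"
    by (simp add: euclidean_product_topology compact_imp_seq_compact)
  moreover have "\<forall>k. s k \<in> (\<Pi>\<^sub>E _\<in>UNIV. cball 0 M)"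
    using order_trans[OF cmod_le_fnorm[OF sf] M] by auto
  ultimately obtain f r where "f \<in> (\<Pi>\<^sub>E _\<in>UNIV. cball 0 M)" and r: "strict_mono r"
    and lim: "(s \<circ> r) \<longlonglongrightarrow> f"
    by (rule seq_compactE[where f=s])
  have c: "(\<lambda>k. s (r k) \<mu>) \<longlonglongrightarrow> f \<mu>" for \<mu>
    using continuous_on_tendsto_compose[OF continuous_on_product_coordinates[of \<mu>] lim]
    by (simp add: o_def)
  have supp: "f \<mu> = 0" if "\<mu> \<notin> fwords n" for \<mu>
    using LIMSEQ_unique[OF c[of \<mu>]] fock_support[OF sf that] by simp
  \<comment> \<open>The limit is known only coordinatewise. The norm bound survives because it can
    be tested on finitely many coordinates at a time.\<close>
  have bd: "L2_set (\<lambda>\<mu>. cmod (f \<mu>)) F \<le> M" if "finite F" for F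
  proof (rule LIMSEQ_le_const2)
    show "(\<lambda>k. L2_set (\<lambda>\<mu>. cmod (s (r k) \<mu>)) F) \<longlonglongrightarrow> L2_set (\<lambda>\<mu>. cmod (f \<mu>)) F"
      unfolding L2_set_def by (intro tendsto_intros c)
    show "\<exists>N. \<forall>k\<ge>N. L2_set (\<lambda>\<mu>. cmod (s (r k) \<mu>)) F \<le> M"
      using L2_set_le_fnorm[OF sf that] M by (meson order_trans)
  qed
  have f: "f \<in> fock n" "fnorm f \<le> M"
    using fock_boundedI[of n f M] supp bd by blast+
  have "fnorm (\<lambda>\<mu>. s (r k) \<mu> - f \<mu>) \<le> M + M" for k
    using fnorm_diff[OF sf[of "r k"] f(1)] M[of "r k"] f(2) by linarith
  moreover have "(\<lambda>k. s (r k) \<mu> - f \<mu>) \<longlonglongrightarrow> 0" for \<mu>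
    using tendsto_diff[OF c[of \<mu>] tendsto_const[of "f \<mu>"]] by simp
  ultimately have "fnull n (\<lambda>k \<mu>. s (r k) \<mu> - f \<mu>)"
    using fock_diff[OF sf f(1)] by (auto simp: fnull_def)
  then show thesis
    using that r f(1) by blast
qed

section \<open>Bounded and compact operators\<close>

lemma bop_closed: "T \<in> bounded_ops n \<Longrightarrow> f \<in> fock n \<Longrightarrow> T f \<in> fock n"
  by (auto simp: bounded_ops_def)

lemma bop_add:
  "T \<in> bounded_ops n \<Longrightarrow> f \<in> fock n \<Longrightarrow> g \<in> fock n \<Longrightarrow> T (\<lambda>\<mu>. f \<mu> + g \<mu>) = (\<lambda>\<mu>. T f \<mu> + T g \<mu>)"
  by (auto simp: bounded_ops_def)

lemma bop_scale:
  "T \<in> bounded_ops n \<Longrightarrow> f \<in> fock n \<Longrightarrow> T (\<lambda>\<mu>. c * f \<mu>) = (\<lambda>\<mu>. c * T f \<mu>)"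
  by (auto simp: bounded_ops_def)

lemma bop_zero: "T \<in> bounded_ops n \<Longrightarrow> T (\<lambda>\<mu>. 0) = (\<lambda>\<mu>. 0)"
  using bop_scale[of T n "\<lambda>\<mu>. 0" 0] by simp

lemma bop_diff:
  "T \<in> bounded_ops n \<Longrightarrow> f \<in> fock n \<Longrightarrow> g \<in> fock n \<Longrightarrow> T (\<lambda>\<mu>. f \<mu> - g \<mu>) = (\<lambda>\<mu>. T f \<mu> - T g \<mu>)"
  using bop_add[OF _ _ fock_minus, of T n f g] bop_scale[of T n g "-1"] by simp

lemma bop_bound:
  assumes "T \<in> bounded_ops n"
  obtains C where "0 \<le> C" "\<And>f. f \<in> fock n \<Longrightarrow> fnorm (T f) \<le> C * fnorm f"
proof -
  obtain C where C: "\<forall>f\<in>fock n. fnorm (T f) \<le> C * fnorm f"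
    using assms by (auto simp: bounded_ops_def)
  have "fnorm (T f) \<le> \<bar>C\<bar> * fnorm f" if "f \<in> fock n" for f
    using C that by (meson abs_ge_self fnorm_nonneg mult_right_mono order_trans)
  then show thesis
    using that[of "\<bar>C\<bar>"] by simp
qed

text \<open>Operators are extensional functions, fixed outside \<open>fock n\<close>. Hence
  agreement on the Fock space is equality, and concrete operators always appear under
  \<open>restrict\<close>.\<close>

lemma bop_eqI:
  assumes "S \<in> bounded_ops n" "T \<in> bounded_ops n" "\<And>f. f \<in> fock n \<Longrightarrow> S f = T f"
  shows "S = T"
  by (rule PiE_ext[of S "fock n" "\<lambda>_. fock n" T]) (use assms in \<open>auto simp: bounded_ops_def\<close>)

lemma bounded_opsI:
  assumes "\<And>f. f \<in> fock n \<Longrightarrow> G f \<in> fock n"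
    and "\<And>f g. f \<in> fock n \<Longrightarrow> g \<in> fock n \<Longrightarrow> G (\<lambda>\<mu>. f \<mu> + g \<mu>) = (\<lambda>\<mu>. G f \<mu> + G g \<mu>)"
    and "\<And>c f. f \<in> fock n \<Longrightarrow> G (\<lambda>\<mu>. c * f \<mu>) = (\<lambda>\<mu>. c * G f \<mu>)"
    and "\<And>f. f \<in> fock n \<Longrightarrow> fnorm (G f) \<le> C * fnorm f"
  shows "restrict G (fock n) \<in> bounded_ops n"
  unfolding bounded_ops_def using assms
  by (auto simp: fock_add fock_scale intro!: exI[of _ C])

text \<open>Rescaling to a unit vector puts the value into the set whose \<open>Sup\<close> is the
  norm; the supremum dominates it only because that set is bounded above. The zero vector cannot be
  rescaled and is treated apart.\<close>

lemma op_norm_bound: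
  assumes T: "T \<in> bounded_ops n" and f: "f \<in> fock n"
  shows "fnorm (T f) \<le> op_norm n T * fnorm f"
proof (cases "fnorm f = 0")
  case True
  then have "f = (\<lambda>\<mu>. 0)"
    using fnorm_eq_0[OF f] by simp
  then show ?thesis
    using bop_zero[OF T] by simp
next
  case False
  then have pos: "0 < fnorm f"
    using fnorm_nonneg[of f] by linarith
  obtain C where C: "0 \<le> C" "\<And>f. f \<in> fock n \<Longrightarrow> fnorm (T f) \<le> C * fnorm f"
    using bop_bound[OF T] by metis
  have bdd: "bdd_above {fnorm (T f) | f. f \<in> fock n \<and> fnorm f \<le> 1}"
    using C by (intro bdd_aboveI[where M=C]) (fastforce intro: order_trans mult_left_le)
  let ?c = "complex_of_real (1 / fnorm f)"
  have "fnorm (\<lambda>\<mu>. ?c * f \<mu>) = 1"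
    unfolding fnorm_scale using pos by (simp add: norm_divide)
  then have "fnorm (T (\<lambda>\<mu>. ?c * f \<mu>)) \<le> op_norm n T"
    unfolding op_norm_def using fock_scale[OF f, of ?c] by (intro cSup_upper[OF _ bdd]) auto
  then show ?thesis
    unfolding bop_scale[OF T f] fnorm_scale using pos by (simp add: norm_divide field_simps)
qed

lemma op_norm_le:
  assumes "\<And>f. f \<in> fock n \<Longrightarrow> fnorm f \<le> 1 \<Longrightarrow> fnorm (T f) \<le> c"
  shows "op_norm n T \<le> c"
  unfolding op_norm_def
proof (rule cSup_least)
  have "fnorm (T (\<lambda>\<mu>. 0)) \<in> {fnorm (T f) | f. f \<in> fock n \<and> fnorm f \<le> 1}"
    using fock_zero[of n] fnorm_zero by force
  then show "{fnorm (T f) | f. f \<in> fock n \<and> fnorm f \<le> 1} \<noteq> {}"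
    by blast
qed (use assms in auto)

lemma op_norm_nonneg: "T \<in> bounded_ops n \<Longrightarrow> 0 \<le> op_norm n T"
proof -
  assume T: "T \<in> bounded_ops n"
  obtain C where C: "0 \<le> C" "\<And>f. f \<in> fock n \<Longrightarrow> fnorm (T f) \<le> C * fnorm f"
    using bop_bound[OF T] by metis
  have "bdd_above {fnorm (T f) | f. f \<in> fock n \<and> fnorm f \<le> 1}"
    using C by (intro bdd_aboveI[where M=C]) (fastforce intro: order_trans mult_left_le)
  then have "fnorm (T (\<lambda>\<mu>. 0)) \<le> op_norm n T"
    unfolding op_norm_def by (rule cSup_upper[rotated]) (auto intro!: exI[of _ "\<lambda>\<mu>. 0"])
  then show ?thesis
    using fnorm_nonneg order_trans by blast
qed

section \<open>Existence and uniqueness of adjoints\<close>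

lemma finner_ftruncate:
  assumes T: "T \<in> bounded_ops n" and f: "f \<in> fock n" and g: "g \<in> fock n"
    and F: "finite F" "F \<subseteq> fwords n"
  shows "finner (T (ftruncate F f)) g = (\<Sum>\<mu>\<in>F. f \<mu> * finner (T (fbasis \<mu>)) g)"
  using F
proof (induction F rule: finite_induct)
  case empty
  have "ftruncate {} f = (\<lambda>\<mu>. 0)"
    by (auto simp: ftruncate_def)
  then show ?case
    by (simp add: bop_zero[OF T] finner_def)
next
  case (insert \<mu> F)
  have w: "fbasis \<mu> \<in> fock n"
    using insert by (intro fock_basis) auto
  have "ftruncate (insert \<mu> F) f = (\<lambda>\<nu>. ftruncate F f \<nu> + f \<mu> * fbasis \<mu> \<nu>)"
    using insert.hyps by (auto simp: ftruncate_def fbasis_def)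
  then have "T (ftruncate (insert \<mu> F) f) = (\<lambda>\<nu>. T (ftruncate F f) \<nu> + f \<mu> * T (fbasis \<mu>) \<nu>)"
    by (simp add: bop_add[OF T] bop_scale[OF T] fock_ftruncate(1)[OF f] fock_scale w)
  then show ?case
    using insert w
    by (simp add: finner_add_left[OF _ _ g] finner_scale_left bop_closed[OF T] fock_ftruncate(1)[OF f] fock_scale)
qed

text \<open>The conjugate transpose of the matrix of \<open>T\<close>: the coordinate of
  \<open>T\<^sup>* g\<close> at \<mu> has to be the pairing of \<open>g\<close> with
  \<open>T e\<^sub>\<mu>\<close>. The explicit formula takes the place of Riesz
  representation.\<close>

definition adjoint_map :: "nat \<Rightarrow> (fvec \<Rightarrow> fvec) \<Rightarrow> fvec \<Rightarrow> fvec" where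
  "adjoint_map n T g = (\<lambda>\<mu>. if \<mu> \<in> fwords n then finner g (T (fbasis \<mu>)) else 0)"

text \<open>Test \<open>T\<close> on a finite piece \<open>h\<close> of the candidate vector itself.
  If \<open>x\<close> is the norm of that piece, then \<open>x\<^sup>2\<close> is the pairing of
  \<open>T h\<close> with \<open>g\<close>, hence at most \<open>C * x * fnorm g\<close>; cancelling
  \<open>x\<close> gives a bound independent of the piece.\<close>

lemma adjoint_map:
  assumes T: "T \<in> bounded_ops n" and C0: "0 \<le> C" and C1: "\<forall>f\<in>fock n. fnorm (T f) \<le> C * fnorm f"
    and g: "g \<in> fock n"
  shows "adjoint_map n T g \<in> fock n" "fnorm (adjoint_map n T g) \<le> C * fnorm g"
    and "\<And>f. f \<in> fock n \<Longrightarrow> finner (T f) g = finner f (adjoint_map n T g)"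
proof -
  note C = C0 bspec[OF C1]
  let ?h = "adjoint_map n T g"
  have "L2_set (\<lambda>\<mu>. cmod (?h \<mu>)) F \<le> C * fnorm g" if F: "finite F" for F
  proof -
    let ?F = "F \<inter> fwords n"
    define x where "x = L2_set (\<lambda>\<mu>. cmod (?h \<mu>)) F"
    define h where "h = ftruncate ?F ?h"
    have "L2_set (\<lambda>\<mu>. cmod (h \<mu>)) G \<le> x" if G: "finite G" for G
    proof -
      have "(\<Sum>\<mu>\<in>G. (cmod (h \<mu>))\<^sup>2) = (\<Sum>\<mu>\<in>G \<inter> ?F. (cmod (?h \<mu>))\<^sup>2)"
        using G by (intro sum.mono_neutral_cong_right) (auto simp: h_def ftruncate_def)
      also have "\<dots> \<le> (\<Sum>\<mu>\<in>F. (cmod (?h \<mu>))\<^sup>2)"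
        using F by (intro sum_mono2) auto
      finally show ?thesis
        by (simp add: x_def L2_set_def)
    qed
    then have h: "h \<in> fock n" "fnorm h \<le> x"
      by (intro fock_boundedI[of n h x]; auto simp: h_def ftruncate_def)+
    have "x\<^sup>2 = (\<Sum>\<mu>\<in>F. (cmod (?h \<mu>))\<^sup>2)"
      by (simp add: x_def L2_set_def sum_nonneg)
    also have "\<dots> = (\<Sum>\<mu>\<in>?F. (cmod (?h \<mu>))\<^sup>2)"
      using F by (intro sum.mono_neutral_cong_right) (auto simp: adjoint_map_def)
    finally have "complex_of_real (x\<^sup>2) = (\<Sum>\<mu>\<in>?F. ?h \<mu> * cnj (?h \<mu>))"
      by (simp add: complex_norm_square del: of_real_power)
    also have "\<dots> = (\<Sum>\<mu>\<in>?F. h \<mu> * finner (T (fbasis \<mu>)) g)"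
      by (intro sum.cong refl) (auto simp: h_def ftruncate_def adjoint_map_def finner_commute[of _ g])
    also have "\<dots> = finner (T h) g"
    proof -
      have "ftruncate ?F h = h"
        by (auto simp: h_def ftruncate_def)
      then show ?thesis
        using finner_ftruncate[OF T h(1) g, of ?F] F by simp
    qed
    finally have "x\<^sup>2 = cmod (finner (T h) g)"
      by (metis norm_of_real abs_power2)
    also have "\<dots> \<le> fnorm (T h) * fnorm g"
      by (rule finner_abs_summable(2)[OF bop_closed[OF T h(1)] g])
    also have "\<dots> \<le> C * fnorm h * fnorm g"
      by (intro mult_right_mono C(2) h) simp
    also have "\<dots> \<le> C * x * fnorm g"
      using C(1) h(2) by (intro mult_right_mono mult_left_mono) auto
    finally have le: "x * x \<le> x * (C * fnorm g)"
      by (simp add: power2_eq_square mult_ac)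
    have "0 \<le> x"
      by (simp add: x_def)
    then have "x \<le> C * fnorm g"
      using le C(1) by (cases "x = 0") auto
    then show ?thesis
      by (simp add: x_def)
  qed
  then show h: "?h \<in> fock n" "fnorm ?h \<le> C * fnorm g"
    by (intro fock_boundedI[of n ?h]; auto simp: adjoint_map_def)+
  fix f assume f: "f \<in> fock n"
  let ?t = "\<lambda>N. ftruncate (short_words n N) f"
  have t: "?t N \<in> fock n" for N
    by (rule fock_ftruncate[OF f])
  have ft: "(\<lambda>\<mu>. f \<mu> - ?t N \<mu>) \<in> fock n" for N
    by (rule fock_diff[OF f t])
  \<comment> \<open>For truncated vectors the adjoint identity is an equality of finite sums. Both
    sides depend continuously on the vector, so it passes to \<open>f\<close> as the tails
    vanish.\<close>
  have eq: "finner (T (?t N)) g = finner (?t N) ?h" for N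
  proof -
    have "finner (T (?t N)) g = (\<Sum>\<mu>\<in>short_words n N. f \<mu> * finner (T (fbasis \<mu>)) g)"
      by (rule finner_ftruncate[OF T f g finite_short_words]) (auto simp: short_words_def)
    also have "\<dots> = (\<Sum>\<mu>\<in>short_words n N. ?t N \<mu> * cnj (?h \<mu>))"
      by (intro sum.cong refl)
        (auto simp: ftruncate_def adjoint_map_def short_words_def finner_commute[of _ g])
    also have "\<dots> = finner (?t N) ?h"
      by (rule finner_finite[symmetric, OF finite_short_words]) (simp add: ftruncate_def)
    finally show ?thesis .
  qed
  have "cmod (finner (T f) g - finner f ?h) \<le> (C * fnorm g + fnorm ?h) * fnorm (\<lambda>\<mu>. f \<mu> - ?t N \<mu>)" for N
  proof -
    have "finner (T f) g - finner f ?h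
        = finner (T (\<lambda>\<mu>. f \<mu> - ?t N \<mu>)) g - finner (\<lambda>\<mu>. f \<mu> - ?t N \<mu>) ?h"
      by (simp add: bop_diff[OF T f t] finner_diff_left[OF bop_closed[OF T f] bop_closed[OF T t] g]
          finner_diff_left[OF f t h(1)] eq)
    also have "cmod \<dots> \<le> cmod (finner (T (\<lambda>\<mu>. f \<mu> - ?t N \<mu>)) g) + cmod (finner (\<lambda>\<mu>. f \<mu> - ?t N \<mu>) ?h)"
      by (rule norm_triangle_ineq4)
    also have "\<dots> \<le> fnorm (T (\<lambda>\<mu>. f \<mu> - ?t N \<mu>)) * fnorm g + fnorm (\<lambda>\<mu>. f \<mu> - ?t N \<mu>) * fnorm ?h"
      by (intro add_mono finner_abs_summable(2)[where n=n] bop_closed[OF T] ft g h)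
    also have "\<dots> \<le> (C * fnorm (\<lambda>\<mu>. f \<mu> - ?t N \<mu>)) * fnorm g + fnorm (\<lambda>\<mu>. f \<mu> - ?t N \<mu>) * fnorm ?h"
      by (intro add_mono mult_right_mono C(2) ft) auto
    finally show ?thesis
      by (simp add: algebra_simps)
  qed
  moreover have "(\<lambda>N. (C * fnorm g + fnorm ?h) * fnorm (\<lambda>\<mu>. f \<mu> - ?t N \<mu>)) \<longlonglongrightarrow> 0"
    by (rule tendsto_mult_right_zero[OF fnorm_ftruncate_tendsto[OF f]])
  ultimately have "cmod (finner (T f) g - finner f ?h) \<le> 0"
    by (intro LIMSEQ_le_const[where a="cmod (finner (T f) g - finner f ?h)"]) auto
  then show "finner (T f) g = finner f ?h"
    by simp
qed

lemma finner_right_cancel: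
  assumes "g \<in> fock n" "h \<in> fock n" "\<And>f. f \<in> fock n \<Longrightarrow> finner f g = finner f h"
  shows "g = h"
proof
  fix \<mu> show "g \<mu> = h \<mu>"
  proof (cases "\<mu> \<in> fwords n")
    case True
    then show ?thesis
      using assms(3)[OF fock_basis[OF True]] finner_commute finner_basis_right by metis
  next
    case False
    then show ?thesis
      using fock_support[OF assms(1)] fock_support[OF assms(2)] by simp
  qed
qed

text \<open>\<open>op_adj\<close> is a definite description, so a concrete adjoint is identified by
  exhibiting a candidate; uniqueness is cancellation in the second argument of
  \<open>finner\<close>.\<close>

lemma op_adj_eqI:
  assumes "T \<in> bounded_ops n" "S \<in> bounded_ops n"
    and "\<And>f g. f \<in> fock n \<Longrightarrow> g \<in> fock n \<Longrightarrow> finner (T f) g = finner f (S g)"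
  shows "op_adj n T = S"
  unfolding op_adj_def
proof (rule the_equality)
  fix R assume R: "R \<in> bounded_ops n \<and> (\<forall>f\<in>fock n. \<forall>g\<in>fock n. finner (T f) g = finner f (R g))"
  show "R = S"
  proof (rule bop_eqI)
    fix g assume "g \<in> fock n"
    then show "R g = S g"
      using R assms by (intro finner_right_cancel) (auto intro: bop_closed)
  qed (use R assms in auto)
qed (use assms in auto)

lemma op_adj:
  assumes T: "T \<in> bounded_ops n"
  shows "op_adj n T \<in> bounded_ops n"
    and "f \<in> fock n \<Longrightarrow> g \<in> fock n \<Longrightarrow> finner (T f) g = finner f (op_adj n T g)"
proof -
  obtain C where C: "0 \<le> C" "\<And>f. f \<in> fock n \<Longrightarrow> fnorm (T f) \<le> C * fnorm f"
    using bop_bound[OF T] by metis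
  then have "\<forall>f\<in>fock n. fnorm (T f) \<le> C * fnorm f"
    by blast
  note adj = adjoint_map[OF T C(1) this]
  let ?S = "restrict (adjoint_map n T) (fock n)"
  have S: "?S \<in> bounded_ops n"
  proof (rule bounded_opsI)
    fix f g assume fg: "f \<in> fock n" "g \<in> fock n"
    show "adjoint_map n T (\<lambda>\<mu>. f \<mu> + g \<mu>) = (\<lambda>\<mu>. adjoint_map n T f \<mu> + adjoint_map n T g \<mu>)"
      using fg by (auto simp: adjoint_map_def intro!: finner_add_left bop_closed[OF T] fock_basis)
    show "fnorm (adjoint_map n T f) \<le> C * fnorm f"
      by (rule adj(2)[OF fg(1)])
  qed (auto simp: adj(1), auto simp: adjoint_map_def finner_scale_left)
  have "op_adj n T = ?S"
    by (rule op_adj_eqI[OF T S]) (simp add: adj)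
  then show "op_adj n T \<in> bounded_ops n"
    and "f \<in> fock n \<Longrightarrow> g \<in> fock n \<Longrightarrow> finner (T f) g = finner f (op_adj n T g)"
    using S adj(3) by simp_all
qed

lemma bop_coordinate:
  assumes "T \<in> bounded_ops n" "f \<in> fock n" "\<mu> \<in> fwords n"
  shows "T f \<mu> = finner f (op_adj n T (fbasis \<mu>))"
  using op_adj(2)[OF assms(1,2) fock_basis[OF assms(3)]] by (simp add: finner_basis_right)

text \<open>The values on the basis determine all coordinates of the adjoints, and the adjoints
  determine the coordinates of the operators. This double passage replaces a density
  argument.\<close>

lemma bop_eq_on_basis:
  assumes S: "S \<in> bounded_ops n" and T: "T \<in> bounded_ops n"
    and eq: "\<And>\<mu>. \<mu> \<in> fwords n \<Longrightarrow> S (fbasis \<mu>) = T (fbasis \<mu>)"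
  shows "S = T"
proof -
  have "op_adj n S = op_adj n T"
  proof (rule bop_eqI)
    fix g assume g: "g \<in> fock n"
    show "op_adj n S g = op_adj n T g"
    proof
      fix \<mu> show "op_adj n S g \<mu> = op_adj n T g \<mu>"
      proof (cases "\<mu> \<in> fwords n")
        case True
        have "op_adj n R g \<mu> = cnj (finner (R (fbasis \<mu>)) g)" if "R \<in> bounded_ops n" for R
          using op_adj(2)[OF that fock_basis[OF True] g] finner_commute[of "fbasis \<mu>"]
          by (simp add: finner_basis_right)
        then show ?thesis
          using S T eq[OF True] by simp
      next
        case False
        then show ?thesis
          using fock_support[OF bop_closed[OF op_adj(1) g]] S T by metis
      qed
    qed
  qed (use S T op_adj in auto)
  then have "S f \<mu> = T f \<mu>" if "f \<in> fock n" for f \<mu>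
    using bop_coordinate[OF S that] bop_coordinate[OF T that] fock_support[OF bop_closed[OF S that]]
      fock_support[OF bop_closed[OF T that]] by (cases "\<mu> \<in> fwords n") auto
  then show ?thesis
    by (intro bop_eqI[OF S T]) auto
qed

lemma op_on_basis_eqI:
  assumes "T \<in> bounded_ops n" "\<And>\<mu>. \<mu> \<in> fwords n \<Longrightarrow> T (fbasis \<mu>) = v \<mu>"
  shows "op_on_basis n v = T"
  unfolding op_on_basis_def by (rule the_equality) (use assms in \<open>auto intro: bop_eq_on_basis\<close>)

section \<open>Compactness as complete continuity\<close>

lemma fnull_bop:
  assumes T: "T \<in> bounded_ops n" and s: "fnull n s"
  shows "fnull n (\<lambda>k. T (s k))"
proof -
  obtain M where sf: "\<And>k. s k \<in> fock n" and M: "\<And>k. fnorm (s k) \<le> M"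
    using s by (auto simp: fnull_def)
  obtain C where C: "0 \<le> C" "\<And>f. f \<in> fock n \<Longrightarrow> fnorm (T f) \<le> C * fnorm f"
    using bop_bound[OF T] by metis
  have "fnorm (T (s k)) \<le> C * M" for k
    using C(2)[OF sf, of k] mult_left_mono[OF M[of k] C(1)] by linarith
  \<comment> \<open>Weak continuity of \<open>T\<close>: the coordinate at \<mu> is the pairing of
    \<open>s k\<close> with the fixed vector \<open>T\<^sup>* e\<^sub>\<mu>\<close>.\<close>
  moreover have "(\<lambda>k. T (s k) \<mu>) \<longlonglongrightarrow> 0" for \<mu>
  proof (cases "\<mu> \<in> fwords n")
    case True
    then show ?thesis
      using fnull_finner[OF s bop_closed[OF op_adj(1)[OF T] fock_basis[OF True]]]
      by (simp add: bop_coordinate[OF T sf])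
  qed (simp add: fock_support[OF bop_closed[OF T sf]])
  ultimately show ?thesis
    using bop_closed[OF T sf] by (auto simp: fnull_def)
qed

text \<open>
  Compactness is equivalent to complete continuity; in this form the ideal properties of the
  compact operators become statements about null sequences.
\<close>

lemma compact_ops_iff:
  "T \<in> compact_ops n \<longleftrightarrow> T \<in> bounded_ops n \<and> (\<forall>s. fnull n s \<longrightarrow> (\<lambda>k. fnorm (T (s k))) \<longlonglongrightarrow> 0)"
    (is "?L \<longleftrightarrow> ?R")
proof
  assume ?L
  then have T: "T \<in> bounded_ops n"
    and cpt: "\<And>s. (\<And>k::nat. s k \<in> fock n \<and> fnorm (s k) \<le> 1) \<Longrightarrow>
       (\<exists>g\<in>fock n. \<exists>r. strict_mono r \<and> (\<lambda>k. fnorm (\<lambda>\<mu>. T (s (r k)) \<mu> - g \<mu>)) \<longlonglongrightarrow> 0)"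
    by (auto simp: compact_ops_def)
  show ?R
  proof (intro conjI allI impI T, rule ccontr)
    fix s assume s: "fnull n s" and "\<not> (\<lambda>k. fnorm (T (s k))) \<longlonglongrightarrow> 0"
    \<comment> \<open>If the norms do not tend to 0, they stay at least \<open>e\<close> for
      infinitely many indices; enumerating these indices gives a subsequence none of whose further
      subsequences has images tending to 0.\<close>
    then obtain e where e: "e > 0" and inf: "\<exists>\<^sub>\<infinity>k. e \<le> fnorm (T (s k))"
      unfolding tendsto_iff not_all not_imp
      by (auto simp: not_eventually cofinite_eq_sequentially[symmetric] not_less dist_real_def)
    obtain M where sf: "\<And>k. s k \<in> fock n" and M: "\<And>k. fnorm (s k) \<le> M"
      using s by (auto simp: fnull_def)
    have M0: "0 \<le> M"
      using M[of 0] fnorm_nonneg[of "s 0"] by linarith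
    define q where "q = enumerate {k. e \<le> fnorm (T (s k))}"
    have infinite: "infinite {k. e \<le> fnorm (T (s k))}"
      using inf by (simp add: frequently_cofinite)
    have q: "strict_mono q"
      unfolding q_def by (rule strict_mono_enumerate[OF infinite])
    have eq: "e \<le> fnorm (T (s (q k)))" for k
      unfolding q_def by (rule CollectD[OF enumerate_in_set[OF infinite]])
    \<comment> \<open>The factor scales the sequence into the unit ball, where the definition of
      compactness applies.\<close>
    define c where "c = complex_of_real (1 / (M + 1))"
    have cmod_c: "cmod c = 1 / (M + 1)"
      unfolding c_def norm_of_real using M0 by simp
    define t where "t k = (\<lambda>\<mu>. c * s (q k) \<mu>)" for k
    have tf: "t k \<in> fock n" and t1: "fnorm (t k) \<le> 1" for k
      using M[of "q k"] M0 fock_scale[OF sf] cmod_c by (simp_all add: t_def fnorm_scale)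
    have "(\<lambda>k. t k \<mu>) \<longlonglongrightarrow> 0" for \<mu>
    proof -
      have "(\<lambda>k. s (q k) \<mu>) \<longlonglongrightarrow> 0"
        using s LIMSEQ_subseq_LIMSEQ[OF _ q, of "\<lambda>k. s k \<mu>"] by (auto simp: fnull_def o_def)
      from tendsto_mult_left[OF this, of c] show ?thesis
        by (simp add: t_def)
    qed
    then have tn: "fnull n t"
      unfolding fnull_def using tf t1 by blast
    have "\<exists>g\<in>fock n. \<exists>r. strict_mono r \<and> (\<lambda>k. fnorm (\<lambda>\<mu>. T (t (r k)) \<mu> - g \<mu>)) \<longlonglongrightarrow> 0"
      by (rule cpt) (simp add: tf t1)
    then obtain g r where g: "g \<in> fock n" and r: "strict_mono r"
      and lim: "(\<lambda>k. fnorm (\<lambda>\<mu>. T (t (r k)) \<mu> - g \<mu>)) \<longlonglongrightarrow> 0"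
      by (elim bexE exE conjE)
    \<comment> \<open>Norm convergence to \<open>g\<close> implies coordinatewise convergence, while
      the images are weakly null by \<open>fnull_bop\<close>. So \<open>g\<close> vanishes, against
      the lower bound on the images.\<close>
    have "g \<mu> = 0" for \<mu>
    proof -
      have "(\<lambda>k. T (t (r k)) \<mu>) \<longlonglongrightarrow> 0"
        using fnull_bop[OF T tn] LIMSEQ_subseq_LIMSEQ[OF _ r, of "\<lambda>k. T (t k) \<mu>"]
        by (auto simp: fnull_def o_def)
      moreover have "(\<lambda>k. T (t (r k)) \<mu> - g \<mu>) \<longlonglongrightarrow> 0"
        by (rule Lim_null_comparison[OF _ lim])
          (auto intro!: always_eventually cmod_le_fnorm[of _ n] fock_diff bop_closed[OF T] tf g)
      ultimately have "(\<lambda>k. T (t (r k)) \<mu> - (T (t (r k)) \<mu> - g \<mu>)) \<longlonglongrightarrow> 0 - 0"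
        by (rule tendsto_diff)
      then show ?thesis
        by (simp add: LIMSEQ_const_iff)
    qed
    then have "(\<lambda>k. fnorm (T (t (r k)))) \<longlonglongrightarrow> 0"
      using lim by simp
    moreover have "cmod c * e \<le> fnorm (T (t (r k)))" for k
      using eq[of "r k"] by (simp add: t_def bop_scale[OF T sf] fnorm_scale mult_left_mono)
    ultimately have "cmod c * e \<le> 0"
      using LIMSEQ_le_const by blast
    moreover have "0 < cmod c * e"
      using e M0 by (simp add: cmod_c)
    ultimately show False
      by linarith
  qed
next
  assume R: ?R
  then have T: "T \<in> bounded_ops n"
    by blast
  show ?L
    unfolding compact_ops_def mem_Collect_eq
  proof (intro conjI T allI impI)
    fix s :: "nat \<Rightarrow> fvec" assume s: "\<forall>k. s k \<in> fock n \<and> fnorm (s k) \<le> 1"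
    then obtain r f where r: "strict_mono r" and f: "f \<in> fock n"
      and null: "fnull n (\<lambda>k \<mu>. s (r k) \<mu> - f \<mu>)"
      using bounded_fock_subsequence[of s n 1] by auto
    \<comment> \<open>Complete continuity is applied to the differences from the weak limit
      \<open>f\<close>, which makes \<open>T f\<close> the norm limit of the images.\<close>
    have "(\<lambda>k. fnorm (T (\<lambda>\<mu>. s (r k) \<mu> - f \<mu>))) \<longlonglongrightarrow> 0"
      by (rule R[THEN conjunct2, rule_format, OF null])
    then have "(\<lambda>k. fnorm (\<lambda>\<mu>. T (s (r k)) \<mu> - T f \<mu>)) \<longlonglongrightarrow> 0"
      using s by (simp add: bop_diff[OF T _ f])
    with r show "\<exists>g\<in>fock n. \<exists>r. strict_mono r \<and> (\<lambda>k. fnorm (\<lambda>\<mu>. T (s (r k)) \<mu> - g \<mu>)) \<longlonglongrightarrow> 0"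
      by (intro bexI[of _ "T f"] exI[of _ r] conjI bop_closed[OF T f])
  qed
qed

section \<open>The bounded operators as a ring\<close>

lemma op_algebra_simps [simp]:
  "carrier (op_algebra n) = bounded_ops n"
  "S \<otimes>\<^bsub>op_algebra n\<^esub> T = compose (fock n) S T"
  "\<one>\<^bsub>op_algebra n\<^esub> = (\<lambda>f\<in>fock n. f)"
  "\<zero>\<^bsub>op_algebra n\<^esub> = (\<lambda>f\<in>fock n. (\<lambda>\<mu>. 0))"
  "S \<oplus>\<^bsub>op_algebra n\<^esub> T = (\<lambda>f\<in>fock n. (\<lambda>\<mu>. S f \<mu> + T f \<mu>))"
  "c \<odot>\<^bsub>op_algebra n\<^esub> T = (\<lambda>f\<in>fock n. (\<lambda>\<mu>. c * T f \<mu>))"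
  "adj (op_algebra n) = op_adj n"
  "nrm (op_algebra n) = op_norm n"
  by (simp_all add: op_algebra_def)

lemma bop_one: "(\<lambda>f\<in>fock n. f) \<in> bounded_ops n"
  by (rule bounded_opsI[where C=1]) auto

lemma bop_zero_op: "(\<lambda>f\<in>fock n. (\<lambda>\<mu>. 0)) \<in> bounded_ops n"
  by (rule bounded_opsI[where C=0]) auto

lemma bop_plus:
  assumes S: "S \<in> bounded_ops n" and T: "T \<in> bounded_ops n"
  shows "(\<lambda>f\<in>fock n. (\<lambda>\<mu>. S f \<mu> + T f \<mu>)) \<in> bounded_ops n"
proof -
  obtain C where C: "\<And>f. f \<in> fock n \<Longrightarrow> fnorm (S f) \<le> C * fnorm f"
    using bop_bound[OF S] by metis
  obtain D where D: "\<And>f. f \<in> fock n \<Longrightarrow> fnorm (T f) \<le> D * fnorm f"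
    using bop_bound[OF T] by metis
  have "fnorm (\<lambda>\<mu>. S f \<mu> + T f \<mu>) \<le> (C + D) * fnorm f" if f: "f \<in> fock n" for f
    using fock_add(2)[OF bop_closed[OF S f] bop_closed[OF T f]] C[OF f] D[OF f]
    by (simp add: distrib_right)
  then show ?thesis
    by (intro bounded_opsI[where C="C + D"])
      (auto simp: bop_add[OF S] bop_add[OF T] bop_scale[OF S] bop_scale[OF T] algebra_simps
        intro!: fock_add(1) bop_closed[OF S] bop_closed[OF T])
qed

lemma bop_smult:
  assumes T: "T \<in> bounded_ops n"
  shows "(\<lambda>f\<in>fock n. (\<lambda>\<mu>. c * T f \<mu>)) \<in> bounded_ops n"
proof -
  obtain D where D: "\<And>f. f \<in> fock n \<Longrightarrow> fnorm (T f) \<le> D * fnorm f"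
    using bop_bound[OF T] by metis
  have "fnorm (\<lambda>\<mu>. c * T f \<mu>) \<le> (cmod c * D) * fnorm f" if f: "f \<in> fock n" for f
    using mult_left_mono[OF D[OF f] norm_ge_zero[of c]] by (simp add: fnorm_scale mult.assoc)
  then show ?thesis
    by (intro bounded_opsI[where C="cmod c * D"])
      (auto simp: bop_add[OF T] bop_scale[OF T] algebra_simps intro!: fock_scale bop_closed[OF T])
qed

lemma bop_compose:
  assumes S: "S \<in> bounded_ops n" and T: "T \<in> bounded_ops n"
  shows "compose (fock n) S T \<in> bounded_ops n"
  unfolding compose_def
proof -
  obtain C where C: "0 \<le> C" "\<And>f. f \<in> fock n \<Longrightarrow> fnorm (S f) \<le> C * fnorm f"
    using bop_bound[OF S] by metis
  obtain D where D: "\<And>f. f \<in> fock n \<Longrightarrow> fnorm (T f) \<le> D * fnorm f"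
    using bop_bound[OF T] by metis
  have "fnorm (S (T f)) \<le> (C * D) * fnorm f" if f: "f \<in> fock n" for f
    using C(2)[OF bop_closed[OF T f]] mult_left_mono[OF D[OF f] C(1)] by (simp add: mult.assoc)
  then show "(\<lambda>f\<in>fock n. S (T f)) \<in> bounded_ops n"
    by (intro bounded_opsI[where C="C * D"])
      (auto simp: bop_add[OF T] bop_scale[OF T] bop_add[OF S] bop_scale[OF S] bop_closed[OF T]
        intro!: bop_closed[OF S])
qed

lemma op_adj_plus:
  assumes S: "S \<in> bounded_ops n" and T: "T \<in> bounded_ops n"
  shows "op_adj n (\<lambda>f\<in>fock n. (\<lambda>\<mu>. S f \<mu> + T f \<mu>)) = (\<lambda>f\<in>fock n. (\<lambda>\<mu>. op_adj n S f \<mu> + op_adj n T f \<mu>))"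
  by (rule op_adj_eqI[OF bop_plus[OF S T] bop_plus[OF op_adj(1)[OF S] op_adj(1)[OF T]]])
    (simp add: finner_add_left[OF bop_closed[OF S] bop_closed[OF T]] op_adj(2)[OF S] op_adj(2)[OF T]
      finner_add_right[OF bop_closed[OF op_adj(1)[OF S]] bop_closed[OF op_adj(1)[OF T]]])

lemma abelian_group_op_algebra: "abelian_group (op_algebra n)"
proof (rule abelian_groupI)
  fix T assume "T \<in> carrier (op_algebra n)"
  then have T: "T \<in> bounded_ops n"
    by simp
  show "\<zero>\<^bsub>op_algebra n\<^esub> \<oplus>\<^bsub>op_algebra n\<^esub> T = T"
    using bop_plus[OF bop_zero_op T] by (intro bop_eqI[OF _ T]) auto
  show "\<exists>S\<in>carrier (op_algebra n). S \<oplus>\<^bsub>op_algebra n\<^esub> T = \<zero>\<^bsub>op_algebra n\<^esub>"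
    using bop_smult[OF T, of "-1"] by (intro bexI[where x="\<lambda>f\<in>fock n. (\<lambda>\<mu>. -1 * T f \<mu>)"]) (auto simp: restrict_def)
qed (auto simp: bop_plus bop_zero_op add.assoc add.commute intro!: restrict_ext)

lemma ring_op_algebra: "ring (op_algebra n)"
proof (rule ringI[OF abelian_group_op_algebra monoidI])
  fix R S T
  assume "R \<in> carrier (op_algebra n)" "S \<in> carrier (op_algebra n)" "T \<in> carrier (op_algebra n)"
  then have R: "R \<in> bounded_ops n" and S: "S \<in> bounded_ops n" and T: "T \<in> bounded_ops n"
    by simp_all
  show "(R \<otimes>\<^bsub>op_algebra n\<^esub> S) \<otimes>\<^bsub>op_algebra n\<^esub> T = R \<otimes>\<^bsub>op_algebra n\<^esub> (S \<otimes>\<^bsub>op_algebra n\<^esub> T)"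
    using bop_closed[OF T] by (auto simp: compose_def restrict_def)
  show "(R \<oplus>\<^bsub>op_algebra n\<^esub> S) \<otimes>\<^bsub>op_algebra n\<^esub> T
      = R \<otimes>\<^bsub>op_algebra n\<^esub> T \<oplus>\<^bsub>op_algebra n\<^esub> S \<otimes>\<^bsub>op_algebra n\<^esub> T"
    using bop_closed[OF T] by (auto simp: compose_def restrict_def)
  show "T \<otimes>\<^bsub>op_algebra n\<^esub> (R \<oplus>\<^bsub>op_algebra n\<^esub> S)
      = T \<otimes>\<^bsub>op_algebra n\<^esub> R \<oplus>\<^bsub>op_algebra n\<^esub> T \<otimes>\<^bsub>op_algebra n\<^esub> S"
    using bop_add[OF T bop_closed[OF R] bop_closed[OF S]] by (auto simp: compose_def restrict_def)
next
  fix T assume "T \<in> carrier (op_algebra n)"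
  then have T: "T \<in> bounded_ops n"
    by simp
  show "\<one>\<^bsub>op_algebra n\<^esub> \<otimes>\<^bsub>op_algebra n\<^esub> T = T"
    using bop_compose[OF bop_one T] bop_closed[OF T] by (intro bop_eqI[OF _ T]) (auto simp: compose_def)
  show "T \<otimes>\<^bsub>op_algebra n\<^esub> \<one>\<^bsub>op_algebra n\<^esub> = T"
    using bop_compose[OF T bop_one] by (intro bop_eqI[OF _ T]) (auto simp: compose_def)
qed (auto simp: bop_compose bop_one)

text \<open>The additive inverse of a ring record is a definite description over its carrier, so
  shrinking the carrier could change its value. Uniqueness of inverses gives the pointwise formula
  for any ring carrier \<open>H\<close>, which covers both the full algebra and the subalgebras for
  which \<open>norm_closed\<close> is stated.\<close>

lemma op_minus:
  assumes R: "ring ((op_algebra n)\<lparr>carrier := H\<rparr>)" and H: "H \<subseteq> bounded_ops n" and "S \<in> H" "T \<in> H"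
  shows "\<ominus>\<^bsub>(op_algebra n)\<lparr>carrier := H\<rparr>\<^esub> T = (\<lambda>f\<in>fock n. (\<lambda>\<mu>. - T f \<mu>))"
    and "S \<ominus>\<^bsub>(op_algebra n)\<lparr>carrier := H\<rparr>\<^esub> T = (\<lambda>f\<in>fock n. (\<lambda>\<mu>. S f \<mu> - T f \<mu>))"
proof -
  interpret ring "(op_algebra n)\<lparr>carrier := H\<rparr>"
    by (rule R)
  let ?U = "\<ominus>\<^bsub>(op_algebra n)\<lparr>carrier := H\<rparr>\<^esub> T"
  have U: "?U \<in> bounded_ops n"
    using a_inv_closed[of T] assms by auto
  have "(\<lambda>f\<in>fock n. (\<lambda>\<mu>. T f \<mu> + ?U f \<mu>)) = (\<lambda>f\<in>fock n. (\<lambda>\<mu>. 0))"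
    using r_neg[of T] assms by simp
  then have "(\<lambda>\<mu>. T f \<mu> + ?U f \<mu>) = (\<lambda>\<mu>. 0)" if "f \<in> fock n" for f
    using that by (auto dest!: fun_cong[of _ _ f])
  then have "?U f \<mu> = - T f \<mu>" if "f \<in> fock n" for f \<mu>
    using fun_cong[of "\<lambda>\<mu>. T f \<mu> + ?U f \<mu>" _ \<mu>] that by (simp add: add_eq_0_iff)
  then show *: "?U = (\<lambda>f\<in>fock n. (\<lambda>\<mu>. - T f \<mu>))"
    using bop_smult[of T n "-1"] assms by (intro bop_eqI[OF U]) auto
  show "S \<ominus>\<^bsub>(op_algebra n)\<lparr>carrier := H\<rparr>\<^esub> T = (\<lambda>f\<in>fock n. (\<lambda>\<mu>. S f \<mu> - T f \<mu>))"
    unfolding a_minus_def * by (auto simp: restrict_def)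
qed

lemma op_algebra_self: "(op_algebra n)\<lparr>carrier := bounded_ops n\<rparr> = op_algebra n"
  by (simp add: op_algebra_def)

lemma op_algebra_minus:
  assumes "S \<in> bounded_ops n" "T \<in> bounded_ops n"
  shows "S \<ominus>\<^bsub>op_algebra n\<^esub> T = (\<lambda>f\<in>fock n. (\<lambda>\<mu>. S f \<mu> - T f \<mu>))"
  using op_minus(2)[where n=n and H="bounded_ops n" and S=S and T=T] assms ring_op_algebra by (simp add: op_algebra_self)

lemma bop_minus:
  assumes S: "S \<in> bounded_ops n" and T: "T \<in> bounded_ops n"
  shows "(\<lambda>f\<in>fock n. (\<lambda>\<mu>. S f \<mu> - T f \<mu>)) \<in> bounded_ops n"
  using abelian_group.minus_closed[OF abelian_group_op_algebra, of S n T] assms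
  by (simp add: op_algebra_minus)

section \<open>The compact operators as a closed two-sided ideal\<close>

lemma compact_bounded: "T \<in> compact_ops n \<Longrightarrow> T \<in> bounded_ops n"
  by (simp add: compact_ops_def)

lemma compact_fnull: "T \<in> compact_ops n \<Longrightarrow> fnull n s \<Longrightarrow> (\<lambda>k. fnorm (T (s k))) \<longlonglongrightarrow> 0"
  by (simp add: compact_ops_iff)

lemma fnull_closed: "fnull n s \<Longrightarrow> s k \<in> fock n"
  by (simp add: fnull_def)

lemma compact_zero: "(\<lambda>f\<in>fock n. (\<lambda>\<mu>. 0)) \<in> compact_ops n"
  by (simp add: compact_ops_iff bop_zero_op fnull_closed)

lemma compact_plus:
  assumes S: "S \<in> compact_ops n" and T: "T \<in> compact_ops n"
  shows "(\<lambda>f\<in>fock n. (\<lambda>\<mu>. S f \<mu> + T f \<mu>)) \<in> compact_ops n"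
  unfolding compact_ops_iff
proof (intro conjI allI impI)
  note ST = compact_bounded[OF S] compact_bounded[OF T]
  show "(\<lambda>f\<in>fock n. (\<lambda>\<mu>. S f \<mu> + T f \<mu>)) \<in> bounded_ops n"
    by (rule bop_plus[OF ST])
  fix s assume s: "fnull n s"
  have "(\<lambda>k. fnorm (S (s k)) + fnorm (T (s k))) \<longlonglongrightarrow> 0"
    using tendsto_add[OF compact_fnull[OF S s] compact_fnull[OF T s]] by simp
  then show "(\<lambda>k. fnorm ((\<lambda>f\<in>fock n. (\<lambda>\<mu>. S f \<mu> + T f \<mu>)) (s k))) \<longlonglongrightarrow> 0"
    by (rule tendsto_0_le[where K=1])
      (simp add: fnull_closed[OF s] fock_add(2)[OF bop_closed[OF ST(1)] bop_closed[OF ST(2)]])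
qed

lemma compact_smult:
  assumes T: "T \<in> compact_ops n"
  shows "(\<lambda>f\<in>fock n. (\<lambda>\<mu>. c * T f \<mu>)) \<in> compact_ops n"
  unfolding compact_ops_iff
proof (intro conjI allI impI bop_smult compact_bounded[OF T])
  fix s assume s: "fnull n s"
  show "(\<lambda>k. fnorm ((\<lambda>f\<in>fock n. (\<lambda>\<mu>. c * T f \<mu>)) (s k))) \<longlonglongrightarrow> 0"
    using tendsto_mult_right_zero[OF compact_fnull[OF T s], of "cmod c"]
    by (simp add: fnull_closed[OF s] fnorm_scale)
qed

text \<open>The bounded factor acts first and preserves weakly null sequences.\<close>

lemma compact_compose_right:
  assumes S: "S \<in> compact_ops n" and T: "T \<in> bounded_ops n"
  shows "compose (fock n) S T \<in> compact_ops n"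
  unfolding compact_ops_iff
proof (intro conjI allI impI bop_compose compact_bounded[OF S] T)
  fix s assume s: "fnull n s"
  show "(\<lambda>k. fnorm (compose (fock n) S T (s k))) \<longlonglongrightarrow> 0"
    using compact_fnull[OF S fnull_bop[OF T s]] by (simp add: compose_eq fnull_closed[OF s])
qed

lemma compact_compose_left:
  assumes S: "S \<in> bounded_ops n" and T: "T \<in> compact_ops n"
  shows "compose (fock n) S T \<in> compact_ops n"
  unfolding compact_ops_iff
proof (intro conjI allI impI bop_compose compact_bounded[OF T] S)
  fix s assume s: "fnull n s"
  obtain C where C: "0 \<le> C" "\<And>f. f \<in> fock n \<Longrightarrow> fnorm (S f) \<le> C * fnorm f"
    using bop_bound[OF S] by metis
  show "(\<lambda>k. fnorm (compose (fock n) S T (s k))) \<longlonglongrightarrow> 0"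
    by (rule tendsto_0_le[OF compact_fnull[OF T s], where K=C])
      (simp add: compose_eq fnull_closed[OF s] C bop_closed[OF compact_bounded[OF T]] mult.commute)
qed

text \<open>\<open>\<parallel>T\<^sup>* f\<parallel>\<^sup>2 = \<langle>T T\<^sup>* f, f\<rangle>\<close>, and \<open>T T\<^sup>*\<close> is compact.\<close>

lemma compact_adj:
  assumes T: "T \<in> compact_ops n"
  shows "op_adj n T \<in> compact_ops n"
  unfolding compact_ops_iff
proof (intro conjI allI impI op_adj(1) compact_bounded[OF T])
  fix s assume s: "fnull n s"
  note Tb = compact_bounded[OF T]
  let ?S = "op_adj n T"
  obtain M where M: "\<And>k. fnorm (s k) \<le> M"
    using s by (auto simp: fnull_def)
  have "(\<lambda>k. fnorm (T (?S (s k)))) \<longlonglongrightarrow> 0"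
    by (rule compact_fnull[OF T fnull_bop[OF op_adj(1)[OF Tb] s]])
  moreover have "(fnorm (?S (s k)))\<^sup>2 \<le> fnorm (T (?S (s k))) * M" for k
  proof -
    have sk: "s k \<in> fock n" and Sk: "?S (s k) \<in> fock n"
      using fnull_closed[OF s] bop_closed[OF op_adj(1)[OF Tb]] by auto
    have "complex_of_real ((fnorm (?S (s k)))\<^sup>2) = finner (T (?S (s k))) (s k)"
      by (simp only: op_adj(2)[OF Tb Sk sk] finner_self[OF Sk])
    then have "(fnorm (?S (s k)))\<^sup>2 = cmod (finner (T (?S (s k))) (s k))"
      by (metis norm_of_real abs_power2)
    also have "\<dots> \<le> fnorm (T (?S (s k))) * fnorm (s k)"
      by (rule finner_abs_summable(2)[OF bop_closed[OF Tb Sk] sk])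
    also have "\<dots> \<le> fnorm (T (?S (s k))) * M"
      by (intro mult_left_mono M fnorm_nonneg)
    finally show ?thesis .
  qed
  ultimately have "(\<lambda>k. (fnorm (?S (s k)))\<^sup>2) \<longlonglongrightarrow> 0"
    by (elim tendsto_0_le[where K=M]) simp
  from tendsto_real_sqrt[OF this] show "(\<lambda>k. fnorm (?S (s k))) \<longlonglongrightarrow> 0"
    by simp
qed

text \<open>A single \<open>S k\<close> close to \<open>T\<close> in norm controls the error
  uniformly along the bounded sequence; complete continuity of that \<open>S k\<close> handles the
  rest.\<close>

lemma compact_limit:
  assumes K: "\<And>k. S k \<in> compact_ops n" and T: "T \<in> bounded_ops n"
    and lim: "(\<lambda>k. op_norm n (\<lambda>f\<in>fock n. (\<lambda>\<mu>. S k f \<mu> - T f \<mu>))) \<longlonglongrightarrow> 0"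
  shows "T \<in> compact_ops n"
  unfolding compact_ops_iff
proof (intro conjI allI impI T LIMSEQ_I)
  fix s and e :: real assume s: "fnull n s" and e: "0 < e"
  obtain M where M: "\<And>k. fnorm (s k) \<le> M"
    using s by (auto simp: fnull_def)
  have M0: "0 \<le> M"
    using M[of 0] fnorm_nonneg[of "s 0"] by linarith
  obtain k where "norm (op_norm n (\<lambda>f\<in>fock n. (\<lambda>\<mu>. S k f \<mu> - T f \<mu>)) - 0) < e / (2 * (M + 1))"
    using LIMSEQ_D[OF lim, of "e / (2 * (M + 1))"] e M0 by auto
  then have k: "op_norm n (\<lambda>f\<in>fock n. (\<lambda>\<mu>. S k f \<mu> - T f \<mu>)) \<le> e / (2 * (M + 1))"
    by simp
  note Sb = compact_bounded[OF K[of k]]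
  obtain N where N: "\<And>j. j \<ge> N \<Longrightarrow> fnorm (S k (s j)) < e / 2"
    using LIMSEQ_D[OF compact_fnull[OF K[of k] s], of "e/2"] e by auto
  have "fnorm (T (s j)) < e" if "j \<ge> N" for j
  proof -
    have sj: "s j \<in> fock n"
      by (rule fnull_closed[OF s])
    have d: "(\<lambda>\<mu>. S k (s j) \<mu> - T (s j) \<mu>) \<in> fock n"
      by (intro fock_diff bop_closed[OF Sb] bop_closed[OF T] sj)
    have "fnorm (T (s j)) \<le> fnorm (S k (s j)) + fnorm (\<lambda>\<mu>. S k (s j) \<mu> - T (s j) \<mu>)"
      using fnorm_diff[OF bop_closed[OF Sb sj] d] by simp
    also have "fnorm (\<lambda>\<mu>. S k (s j) \<mu> - T (s j) \<mu>) \<le> e / (2 * (M + 1)) * M"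
    proof -
      have "fnorm (\<lambda>\<mu>. S k (s j) \<mu> - T (s j) \<mu>)
          \<le> op_norm n (\<lambda>f\<in>fock n. (\<lambda>\<mu>. S k f \<mu> - T f \<mu>)) * fnorm (s j)"
        using op_norm_bound[OF bop_minus[OF Sb T] sj] sj by simp
      also have "\<dots> \<le> e / (2 * (M + 1)) * M"
        using e M0 by (intro mult_mono k M) auto
      finally show ?thesis .
    qed
    also have "e / (2 * (M + 1)) * M \<le> e / 2"
      using M0 e by (simp add: field_simps)
    finally show ?thesis
      using N[OF that] by linarith
  qed
  then show "\<exists>N. \<forall>j\<ge>N. norm (fnorm (T (s j)) - 0) < e"
    by auto
qed

text \<open>The carrier is left open because two cases are needed: the full algebra, where the
  Calkin quotient is formed, and the subalgebra in which the compact operators are to be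
  essential.\<close>

lemma ideal_compact_ops:
  assumes R: "ring ((op_algebra n)\<lparr>carrier := H\<rparr>)" and H: "H \<subseteq> bounded_ops n"
    and KH: "compact_ops n \<subseteq> H"
  shows "ideal (compact_ops n) ((op_algebra n)\<lparr>carrier := H\<rparr>)"
proof (rule idealI[OF R group.subgroupI])
  interpret ring "(op_algebra n)\<lparr>carrier := H\<rparr>"
    by (rule R)
  show "group (add_monoid ((op_algebra n)\<lparr>carrier := H\<rparr>))"
    by (rule a_group)
  show "compact_ops n \<noteq> {}"
    using compact_zero by blast
  fix T assume T: "T \<in> compact_ops n"
  have "\<ominus>\<^bsub>(op_algebra n)\<lparr>carrier := H\<rparr>\<^esub> T \<in> compact_ops n"
    using op_minus(1)[OF R H] T KH compact_smult[OF T, of "-1"] by auto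
  then show "inv\<^bsub>add_monoid ((op_algebra n)\<lparr>carrier := H\<rparr>)\<^esub> T \<in> compact_ops n"
    by (simp add: a_inv_def)
qed (use KH H in \<open>auto simp: compact_plus compact_compose_left compact_compose_right subset_iff\<close>)

lemma norm_closed_compact_ops:
  assumes R: "ring ((op_algebra n)\<lparr>carrier := H\<rparr>)" and H: "H \<subseteq> bounded_ops n"
    and KH: "compact_ops n \<subseteq> H"
  shows "norm_closed (compact_ops n) ((op_algebra n)\<lparr>carrier := H\<rparr>)"
  unfolding norm_closed_def
proof (intro allI ballI impI, elim conjE)
  fix S T assume T: "T \<in> carrier ((op_algebra n)\<lparr>carrier := H\<rparr>)" and S: "\<forall>k::nat. S k \<in> compact_ops n"
    and lim: "(\<lambda>k. nrm ((op_algebra n)\<lparr>carrier := H\<rparr>) (S k \<ominus>\<^bsub>(op_algebra n)\<lparr>carrier := H\<rparr>\<^esub> T)) \<longlonglongrightarrow> 0"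
  show "T \<in> compact_ops n"
  proof (rule compact_limit)
    show "(\<lambda>k. op_norm n (\<lambda>f\<in>fock n. (\<lambda>\<mu>. S k f \<mu> - T f \<mu>))) \<longlonglongrightarrow> 0"
      using lim op_minus(2)[OF R H] S T KH by (simp add: subset_iff)
  qed (use S T H in auto)
qed

section \<open>The matrix units generated by the creation operators\<close>

text \<open>The coordinate form of \<open>S\<^sub>i\<close>, whereas \<open>creation\<close>
  describes it only through its values on the basis.\<close>

definition left_shift :: "nat \<Rightarrow> fvec \<Rightarrow> fvec" where
  "left_shift i f = (\<lambda>\<mu>. case \<mu> of [] \<Rightarrow> 0 | j # \<nu> \<Rightarrow> if j = i then f \<nu> else 0)"

lemma left_shift_simps [simp]:
  "left_shift i f [] = 0" "left_shift i f (j # \<nu>) = (if j = i then f \<nu> else 0)"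
  by (simp_all add: left_shift_def)

lemma left_shift_outside: "\<mu> \<notin> range (Cons i) \<Longrightarrow> left_shift i f \<mu> = 0"
  by (cases \<mu>) auto

lemma fwords_Cons [simp]: "i # \<mu> \<in> fwords n \<longleftrightarrow> i \<in> {1..n} \<and> \<mu> \<in> fwords n"
  by (auto simp: fwords_def)

lemma fwords_Nil [simp]: "[] \<in> fwords n"
  by (simp add: fwords_def)

lemma fock_left_shift:
  assumes i: "i \<in> {1..n}" and f: "f \<in> fock n"
  shows "left_shift i f \<in> fock n" "fnorm (left_shift i f) \<le> fnorm f"
proof -
  have "L2_set (\<lambda>\<mu>. cmod (left_shift i f \<mu>)) F \<le> fnorm f" if F: "finite F" for F
  proof -
    let ?F = "Cons i -` F"
    have fin: "finite ?F"
      using F by (intro finite_vimageI) auto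
    have "(\<Sum>\<mu>\<in>F. (cmod (left_shift i f \<mu>))\<^sup>2) = (\<Sum>\<mu>\<in>Cons i ` ?F. (cmod (left_shift i f \<mu>))\<^sup>2)"
      using F by (intro sum.mono_neutral_right) (auto simp: left_shift_outside)
    also have "\<dots> = (\<Sum>\<nu>\<in>?F. (cmod (f \<nu>))\<^sup>2)"
      by (subst sum.reindex) auto
    finally show ?thesis
      using L2_set_le_fnorm[OF f fin] by (simp add: L2_set_def)
  qed
  moreover have "left_shift i f \<mu> = 0" if "\<mu> \<notin> fwords n" for \<mu>
    using that i fock_support[OF f] by (cases \<mu>) auto
  ultimately show "left_shift i f \<in> fock n" "fnorm (left_shift i f) \<le> fnorm f"
    using fock_boundedI[of n "left_shift i f" "fnorm f"] by blast+
qed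

text \<open>The vector is \<open>S\<^sub>i\<^sup>* f\<close> in coordinates. Since
  \<open>Cons i\<close> is injective, its finite square sums are square sums of \<open>f\<close>
  over image sets.\<close>

lemma fock_back_shift:
  assumes i: "i \<in> {1..n}" and f: "f \<in> fock n"
  shows "(\<lambda>\<nu>. f (i # \<nu>)) \<in> fock n" "fnorm (\<lambda>\<nu>. f (i # \<nu>)) \<le> fnorm f"
proof -
  have "L2_set (\<lambda>\<nu>. cmod (f (i # \<nu>))) F \<le> fnorm f" if F: "finite F" for F
    using L2_set_le_fnorm[OF f finite_imageI[OF F, of "Cons i"]]
    by (simp add: L2_set_def sum.reindex)
  moreover have "f (i # \<nu>) = 0" if "\<nu> \<notin> fwords n" for \<nu>
    using that fock_support[OF f] by simp
  ultimately show "(\<lambda>\<nu>. f (i # \<nu>)) \<in> fock n" "fnorm (\<lambda>\<nu>. f (i # \<nu>)) \<le> fnorm f"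
    using fock_boundedI[of n "\<lambda>\<nu>. f (i # \<nu>)" "fnorm f"] by blast+
qed

lemma bop_left_shift: "i \<in> {1..n} \<Longrightarrow> restrict (left_shift i) (fock n) \<in> bounded_ops n"
  by (rule bounded_opsI[where C=1])
    (simp_all add: fock_left_shift[of i n], auto simp: left_shift_def fun_eq_iff split: list.split)

lemma bop_back_shift: "i \<in> {1..n} \<Longrightarrow> (\<lambda>f\<in>fock n. (\<lambda>\<nu>. f (i # \<nu>))) \<in> bounded_ops n"
  by (rule bounded_opsI[where C=1]) (auto simp: fock_back_shift)

lemma creation_eq: "i \<in> {1..n} \<Longrightarrow> creation n i = restrict (left_shift i) (fock n)"
  unfolding creation_def
  by (rule op_on_basis_eqI[OF bop_left_shift])
    (simp_all add: fock_basis, auto simp: fbasis_def left_shift_def fun_eq_iff split: list.split)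

lemma finner_left_shift: "finner (left_shift i f) g = finner f (\<lambda>\<nu>. g (i # \<nu>))"
proof -
  have "finner (left_shift i f) g = (\<Sum>\<^sub>\<infinity>\<mu>\<in>range (Cons i). left_shift i f \<mu> * cnj (g \<mu>))"
    unfolding finner_def by (rule infsum_cong_neutral) (auto simp: left_shift_outside)
  also have "\<dots> = finner f (\<lambda>\<nu>. g (i # \<nu>))"
    unfolding finner_def by (subst infsum_reindex) (auto simp: o_def)
  finally show ?thesis .
qed

lemma adj_creation: "i \<in> {1..n} \<Longrightarrow> op_adj n (creation n i) = (\<lambda>f\<in>fock n. (\<lambda>\<nu>. f (i # \<nu>)))"
  by (rule op_adj_eqI) (simp_all add: creation_eq bop_left_shift bop_back_shift finner_left_shift)

text \<open>The operator sending \<open>f\<close> to its pairing with \<open>e\<^sub>\<nu>\<close>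
  times \<open>g\<close>; for \<open>g = e\<^sub>\<mu>\<close> it is a matrix unit. A word suffices
  as second parameter, because an operator composed with a finite coordinate projection is a sum of
  such terms.\<close>

definition rank_one :: "nat \<Rightarrow> fvec \<Rightarrow> nat list \<Rightarrow> fvec \<Rightarrow> fvec" where
  "rank_one n g \<nu> = (\<lambda>f\<in>fock n. (\<lambda>\<kappa>. f \<nu> * g \<kappa>))"

lemma bop_rank_one: "g \<in> fock n \<Longrightarrow> rank_one n g \<nu> \<in> bounded_ops n"
  unfolding rank_one_def
  by (rule bounded_opsI[where C="fnorm g"])
    (auto simp: fock_scale fnorm_scale distrib_right mult.assoc mult.commute[of "fnorm g"]
      intro!: mult_right_mono cmod_le_fnorm)

lemma compact_rank_one:
  assumes g: "g \<in> fock n"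
  shows "rank_one n g \<nu> \<in> compact_ops n"
  unfolding compact_ops_iff
proof (intro conjI allI impI bop_rank_one g)
  fix s assume s: "fnull n s"
  then have "(\<lambda>k. s k \<nu>) \<longlonglongrightarrow> 0"
    by (simp add: fnull_def)
  from tendsto_mult_left_zero[OF tendsto_norm_zero[OF this], of "fnorm g"]
  show "(\<lambda>k. fnorm (rank_one n g \<nu> (s k))) \<longlonglongrightarrow> 0"
    by (simp add: rank_one_def fnull_closed[OF s] fnorm_scale)
qed

lemma bop_compose_ftruncate:
  assumes T: "T \<in> bounded_ops n"
  shows "(\<lambda>f\<in>fock n. T (ftruncate F f)) \<in> bounded_ops n"
proof -
  obtain C where C: "0 \<le> C" "\<And>f. f \<in> fock n \<Longrightarrow> fnorm (T f) \<le> C * fnorm f"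
    using bop_bound[OF T] by metis
  have t: "ftruncate F f \<in> fock n" if "f \<in> fock n" for f
    by (rule fock_ftruncate(1)[OF that])
  have "T (ftruncate F (\<lambda>\<mu>. f \<mu> + g \<mu>)) = (\<lambda>\<mu>. T (ftruncate F f) \<mu> + T (ftruncate F g) \<mu>)"
    if "f \<in> fock n" "g \<in> fock n" for f g
  proof -
    have "ftruncate F (\<lambda>\<mu>. f \<mu> + g \<mu>) = (\<lambda>\<mu>. ftruncate F f \<mu> + ftruncate F g \<mu>)"
      by (auto simp: ftruncate_def)
    then show ?thesis
      by (simp add: bop_add[OF T t[OF that(1)] t[OF that(2)]])
  qed
  moreover have "T (ftruncate F (\<lambda>\<mu>. c * f \<mu>)) = (\<lambda>\<mu>. c * T (ftruncate F f) \<mu>)" if "f \<in> fock n" for c f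
  proof -
    have "ftruncate F (\<lambda>\<mu>. c * f \<mu>) = (\<lambda>\<mu>. c * ftruncate F f \<mu>)"
      by (auto simp: ftruncate_def)
    then show ?thesis
      by (simp add: bop_scale[OF T t[OF that]])
  qed
  moreover have "fnorm (T (ftruncate F f)) \<le> C * fnorm f" if "f \<in> fock n" for f
    using C(2)[OF t[OF that]] mult_left_mono[OF fock_ftruncate(2)[OF that, of F] C(1)] by linarith
  ultimately show ?thesis
    by (intro bounded_opsI[where C=C]) (auto intro!: bop_closed[OF T] t)
qed

text \<open>The tails \<open>f\<^sub>N - P\<^sub>N f\<^sub>N\<close> of almost norming unit vectors \<open>f\<^sub>N\<close> form a null sequence.\<close>

lemma compact_ftruncate_tendsto:
  assumes T: "T \<in> compact_ops n"
  shows "(\<lambda>N. op_norm n (\<lambda>f\<in>fock n. (\<lambda>\<mu>. T (ftruncate (short_words n N) f) \<mu> - T f \<mu>))) \<longlonglongrightarrow> 0"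
proof -
  note Tb = compact_bounded[OF T]
  define D where "D N = (\<lambda>f\<in>fock n. (\<lambda>\<mu>. T (ftruncate (short_words n N) f) \<mu> - T f \<mu>))" for N
  have D: "D N \<in> bounded_ops n" for N
    using bop_minus[OF bop_compose_ftruncate[OF Tb] Tb, of "short_words n N"] by (simp add: D_def cong: restrict_cong)
  \<comment> \<open>The slack \<open>1 / Suc N\<close> avoids having to show that the supremum is
    attained, and it disappears in the limit.\<close>
  have "\<exists>f. f \<in> fock n \<and> fnorm f \<le> 1 \<and> op_norm n (D N) \<le> fnorm (D N f) + 1 / Suc N" for N
  proof (rule ccontr)
    assume "\<not> ?thesis"
    then have "op_norm n (D N) \<le> op_norm n (D N) - 1 / Suc N"
      by (intro op_norm_le) (force simp: not_le)
    then show False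
      by simp
  qed
  then obtain h where h: "\<And>N. h N \<in> fock n" "\<And>N. fnorm (h N) \<le> 1"
    and le: "\<And>N. op_norm n (D N) \<le> fnorm (D N (h N)) + 1 / Suc N"
    by metis
  define s where "s N = (\<lambda>\<mu>. h N \<mu> - ftruncate (short_words n N) (h N) \<mu>)" for N
  have sf: "s N \<in> fock n" "fnorm (s N) \<le> 1" for N
    using fock_ftruncate[OF h(1), of "- short_words n N" N] h(2)[of N] unfolding s_def tail_eq by auto
  have "(\<lambda>N. s N \<mu>) \<longlonglongrightarrow> 0" for \<mu>
  \<comment> \<open>Each fixed coordinate of the tails is 0 as soon as \<open>N\<close> reaches the
    length of the word.\<close>
  proof (rule tendsto_eventually)
    have "s N \<mu> = 0" if "N \<ge> length \<mu>" for N
      using that fock_support[OF h(1)] by (auto simp: s_def ftruncate_def short_words_def)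
    then show "\<forall>\<^sub>F N in sequentially. s N \<mu> = 0"
      by (auto simp: eventually_sequentially)
  qed
  with sf have "fnull n s"
    unfolding fnull_def by blast
  from compact_fnull[OF T this] have "(\<lambda>N. fnorm (T (s N)) + 1 / Suc N) \<longlonglongrightarrow> 0 + 0"
    by (intro tendsto_add LIMSEQ_Suc[OF lim_1_over_n])
  moreover have "fnorm (D N (h N)) = fnorm (T (s N))" for N
    by (simp add: D_def h(1) s_def bop_diff[OF Tb h(1) fock_ftruncate(1)[OF h(1)]] fnorm_minus_commute)
  ultimately have "(\<lambda>N. op_norm n (D N)) \<longlonglongrightarrow> 0"
    using le op_norm_nonneg[OF D]
    by (intro tendsto_sandwich[where f="\<lambda>_. 0" and g="\<lambda>N. op_norm n (D N)"
          and h="\<lambda>N. fnorm (T (s N)) + 1 / Suc N"]) auto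
  then show ?thesis
    by (simp add: D_def)
qed

lemma subalgebra_limit:
  assumes H: "cstar_subalgebra H (op_algebra n)" and S: "\<And>k::nat. S k \<in> H" and T: "T \<in> bounded_ops n"
    and lim: "(\<lambda>k. op_norm n (\<lambda>f\<in>fock n. (\<lambda>\<mu>. S k f \<mu> - T f \<mu>))) \<longlonglongrightarrow> 0"
  shows "T \<in> H"
proof -
  have "S k \<in> bounded_ops n" for k
    using H S by (auto simp: cstar_subalgebra_def)
  then have "(\<lambda>k. nrm (op_algebra n) (S k \<ominus>\<^bsub>op_algebra n\<^esub> T)) \<longlonglongrightarrow> 0"
    using lim by (simp add: op_algebra_minus T)
  then show ?thesis
    using H S T unfolding cstar_subalgebra_def norm_closed_def op_algebra_simps(1) by blast
qed

lemma subalgebra_closed: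
  assumes "cstar_subalgebra H (op_algebra n)"
  shows "H \<subseteq> bounded_ops n" and "(\<lambda>f\<in>fock n. (\<lambda>\<mu>. 0)) \<in> H"
    and "S \<in> H \<Longrightarrow> T \<in> H \<Longrightarrow> (\<lambda>f\<in>fock n. (\<lambda>\<mu>. S f \<mu> + T f \<mu>)) \<in> H"
    and "S \<in> H \<Longrightarrow> T \<in> H \<Longrightarrow> compose (fock n) S T \<in> H"
    and "T \<in> H \<Longrightarrow> (\<lambda>f\<in>fock n. (\<lambda>\<mu>. c * T f \<mu>)) \<in> H"
    and "T \<in> H \<Longrightarrow> op_adj n T \<in> H"
  using assms unfolding cstar_subalgebra_def op_algebra_simps by blast+

section \<open>Matrix units and compact operators in a closed star-subalgebra containing the
  creation operators\<close>

context
  fixes n :: nat and H :: "(fvec \<Rightarrow> fvec) set"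
  assumes H: "cstar_subalgebra H (op_algebra n)" and n: "1 \<le> n"
    and gen: "creation n ` {1..n} \<subseteq> H"
begin

lemma gen_closed:
  assumes i: "i \<in> {1..n}"
  shows "restrict (left_shift i) (fock n) \<in> H" "(\<lambda>f\<in>fock n. (\<lambda>\<nu>. f (i # \<nu>))) \<in> H"
proof -
  have c: "creation n i \<in> H"
    using gen i by blast
  then show "restrict (left_shift i) (fock n) \<in> H"
    by (simp only: creation_eq[OF i])
  show "(\<lambda>f\<in>fock n. (\<lambda>\<nu>. f (i # \<nu>))) \<in> H"
    using subalgebra_closed(6)[OF H c] by (simp only: adj_creation[OF i])
qed

text \<open>A unit is not part of \<open>cstar_subalgebra\<close>; it is recovered as
  \<open>S\<^sub>1\<^sup>* S\<^sub>1\<close>, which requires at least one letter.\<close>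

lemma one_in_subalgebra: "(\<lambda>f\<in>fock n. f) \<in> H"
proof -
  have 1: "1 \<in> {1..n}"
    using n by simp
  have "compose (fock n) (\<lambda>f\<in>fock n. (\<lambda>\<nu>. f (1 # \<nu>))) (restrict (left_shift 1) (fock n)) = (\<lambda>f\<in>fock n. f)"
    unfolding compose_def
    by (intro restrict_ext) (simp add: fock_left_shift(1)[OF 1, unfolded One_nat_def])
  then show ?thesis
    using subalgebra_closed(4)[OF H gen_closed(2)[OF 1] gen_closed(1)[OF 1]] by simp
qed

text \<open>The operator is the sum of \<open>S\<^sub>i S\<^sub>i\<^sup>*\<close> over
  \<open>I\<close>, since \<open>S\<^sub>i S\<^sub>i\<^sup>*\<close> keeps exactly the coordinates
  at words beginning with \<open>i\<close>. Growing \<open>I\<close> letter by letter adds one such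
  term.\<close>

lemma letter_projection_in_subalgebra:
  assumes "finite I" "I \<subseteq> {1..n}"
  shows "(\<lambda>f\<in>fock n. (\<lambda>\<mu>. if \<mu> \<noteq> [] \<and> hd \<mu> \<in> I then f \<mu> else 0)) \<in> H"
  using assms
proof (induction I rule: finite_induct)
  case empty
  then show ?case
    using subalgebra_closed(2)[OF H] by (simp add: restrict_def)
next
  case (insert i I)
  let ?P = "\<lambda>I. (\<lambda>f\<in>fock n. (\<lambda>\<mu>. if \<mu> \<noteq> [] \<and> hd \<mu> \<in> I then f \<mu> else 0))"
  have i: "i \<in> {1..n}"
    using insert.prems by simp
  have P: "?P I \<in> H"
    by (rule insert.IH) (use insert.prems in simp)
  let ?SS = "compose (fock n) (restrict (left_shift i) (fock n)) (\<lambda>f\<in>fock n. (\<lambda>\<nu>. f (i # \<nu>)))"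
  have eq: "?P (insert i I) = (\<lambda>f\<in>fock n. (\<lambda>\<mu>. ?P I f \<mu> + ?SS f \<mu>))"
  proof (intro restrict_ext ext)
    fix f \<mu> assume f: "f \<in> fock n"
    show "(if \<mu> \<noteq> [] \<and> hd \<mu> \<in> insert i I then f \<mu> else 0) = ?P I f \<mu> + ?SS f \<mu>"
      using insert.hyps f by (cases \<mu>) (auto simp: compose_def fock_back_shift(1)[OF i])
  qed
  show ?case
    unfolding eq
    by (rule subalgebra_closed(3)[OF H P subalgebra_closed(4)[OF H gen_closed(1)[OF i] gen_closed(2)[OF i]]])
qed

lemma vacuum_projection_in_subalgebra: "rank_one n (fbasis []) [] \<in> H"
proof -
  let ?P = "\<lambda>f\<in>fock n. (\<lambda>\<mu>. if \<mu> \<noteq> [] \<and> hd \<mu> \<in> {1..n} then f \<mu> else 0)"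
  have "rank_one n (fbasis []) [] = (\<lambda>f\<in>fock n. (\<lambda>\<mu>. (\<lambda>f\<in>fock n. f) f \<mu> + (\<lambda>f\<in>fock n. (\<lambda>\<mu>. -1 * ?P f \<mu>)) f \<mu>))"
    unfolding rank_one_def
  proof (intro restrict_ext ext)
    fix f \<mu> assume f: "f \<in> fock n"
    \<comment> \<open>A nonempty list whose first entry is not a letter survives the subtraction of
      \<open>?P\<close>, but it is not a word, so \<open>f\<close> vanishes there.\<close>
    show "f [] * fbasis [] \<mu> = (\<lambda>f\<in>fock n. f) f \<mu> + (\<lambda>f\<in>fock n. (\<lambda>\<mu>. -1 * ?P f \<mu>)) f \<mu>"
      using f fock_support[OF f, of \<mu>] by (cases \<mu>) (auto simp: fbasis_def)
  qed
  then show ?thesis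
    using subalgebra_closed(3)[OF H one_in_subalgebra
        subalgebra_closed(5)[OF H letter_projection_in_subalgebra[OF finite_atLeastAtMost order.refl], of "-1"]]
    by simp
qed

text \<open>Multiplying by \<open>S\<^sub>i\<close> on the left prepends \<open>i\<close> to the row
  word, and multiplying by \<open>S\<^sub>i\<^sup>*\<close> on the right prepends it to the column
  word. The inner induction builds the row over the empty column word, starting from the vacuum
  projection; the outer one builds the column.\<close>

lemma matrix_unit_in_subalgebra:
  assumes "\<mu> \<in> fwords n" "\<nu> \<in> fwords n"
  shows "rank_one n (fbasis \<mu>) \<nu> \<in> H"
  using assms(2)
proof (induction \<nu>)
  case Nil
  show ?case
    using assms(1)
  proof (induction \<mu>)
    case Nil
    show ?case
      by (rule vacuum_projection_in_subalgebra)
  next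
    case (Cons i \<mu>)
    then have i: "i \<in> {1..n}" and \<mu>: "fbasis \<mu> \<in> fock n"
      by (auto simp: fock_basis)
    have "rank_one n (fbasis (i # \<mu>)) [] = compose (fock n) (restrict (left_shift i) (fock n)) (rank_one n (fbasis \<mu>) [])"
      unfolding compose_def rank_one_def
      by (intro restrict_ext ext)
        (simp add: fock_scale[OF \<mu>], simp add: fbasis_def left_shift_def split: list.split)
    then show ?case
      using subalgebra_closed(4)[OF H gen_closed(1)[OF i]] Cons by simp
  qed
next
  case (Cons i \<nu>)
  then have i: "i \<in> {1..n}"
    by simp
  have "rank_one n (fbasis \<mu>) (i # \<nu>) = compose (fock n) (rank_one n (fbasis \<mu>) \<nu>) (\<lambda>f\<in>fock n. (\<lambda>\<nu>. f (i # \<nu>)))"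
    unfolding compose_def rank_one_def
    by (intro restrict_ext ext) (auto simp: fock_back_shift(1)[OF i])
  then show ?case
    using subalgebra_closed(4)[OF H _ gen_closed(2)[OF i]] Cons by simp
qed

text \<open>Truncating \<open>g\<close> gives finite combinations of matrix units. The error in
  operator norm is at most the norm of the tail of \<open>g\<close>, because a coordinate of a
  vector in the unit ball has modulus at most 1.\<close>

lemma rank_one_in_subalgebra:
  assumes g: "g \<in> fock n" and \<nu>: "\<nu> \<in> fwords n"
  shows "rank_one n g \<nu> \<in> H"
proof (rule subalgebra_limit[OF H _ bop_rank_one[OF g]])
  have "rank_one n (ftruncate F g) \<nu> \<in> H" if "finite F" "F \<subseteq> fwords n" for F
    using that
  proof (induction F rule: finite_induct)
    case empty
    have "rank_one n (ftruncate {} g) \<nu> = (\<lambda>f\<in>fock n. (\<lambda>\<mu>. 0))"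
      by (auto simp: rank_one_def ftruncate_def)
    then show ?case
      using subalgebra_closed(2)[OF H] by (simp add: restrict_def)
  next
    case (insert \<mu> F)
    have eq: "rank_one n (ftruncate (insert \<mu> F) g) \<nu>
        = (\<lambda>f\<in>fock n. (\<lambda>\<kappa>. rank_one n (ftruncate F g) \<nu> f \<kappa>
            + (\<lambda>f\<in>fock n. (\<lambda>\<kappa>. g \<mu> * rank_one n (fbasis \<mu>) \<nu> f \<kappa>)) f \<kappa>))"
      using insert.hyps by (intro ext) (auto simp: rank_one_def ftruncate_def fbasis_def)
    show ?case
      unfolding eq using insert
      by (intro subalgebra_closed(3)[OF H] subalgebra_closed(5)[OF H] matrix_unit_in_subalgebra[OF _ \<nu>]) auto
  qed
  then show "rank_one n (ftruncate (short_words n k) g) \<nu> \<in> H" for k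
    using finite_short_words[of n k] by (auto simp: short_words_def)
  show "(\<lambda>k. op_norm n (\<lambda>f\<in>fock n. (\<lambda>\<mu>. rank_one n (ftruncate (short_words n k) g) \<nu> f \<mu> - rank_one n g \<nu> f \<mu>)))
      \<longlonglongrightarrow> 0"
  proof (rule tendsto_sandwich[OF _ _ tendsto_const fnorm_ftruncate_tendsto[OF g]])
    let ?D = "\<lambda>k. \<lambda>f\<in>fock n. (\<lambda>\<mu>. rank_one n (ftruncate (short_words n k) g) \<nu> f \<mu> - rank_one n g \<nu> f \<mu>)"
    have "0 \<le> op_norm n (?D k)" for k
      by (intro op_norm_nonneg bop_minus bop_rank_one fock_ftruncate(1) g)
    then show "\<forall>\<^sub>F k in sequentially. 0 \<le> op_norm n (?D k)"
      by simp
    have "op_norm n (?D k) \<le> fnorm (\<lambda>\<mu>. g \<mu> - ftruncate (short_words n k) g \<mu>)" for k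
    proof (rule op_norm_le)
      fix f assume f: "f \<in> fock n" "fnorm f \<le> 1"
      have "?D k f = (\<lambda>\<mu>. f \<nu> * (ftruncate (short_words n k) g \<mu> - g \<mu>))"
        using f by (auto simp: rank_one_def right_diff_distrib)
      then have "fnorm (?D k f) = cmod (f \<nu>) * fnorm (\<lambda>\<mu>. g \<mu> - ftruncate (short_words n k) g \<mu>)"
        by (simp add: fnorm_scale fnorm_minus_commute[of g])
      also have "\<dots> \<le> 1 * fnorm (\<lambda>\<mu>. g \<mu> - ftruncate (short_words n k) g \<mu>)"
        using cmod_le_fnorm[OF f(1), of \<nu>] f(2) by (intro mult_right_mono) auto
      finally show "fnorm (?D k f) \<le> fnorm (\<lambda>\<mu>. g \<mu> - ftruncate (short_words n k) g \<mu>)"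
        by simp
    qed
    then show "\<forall>\<^sub>F k in sequentially. op_norm n (?D k) \<le> fnorm (\<lambda>\<mu>. g \<mu> - ftruncate (short_words n k) g \<mu>)"
      by simp
  qed
qed

text \<open>On a finite set \<open>F\<close> of words, \<open>T\<close> composed with the coordinate
  projection is the sum over \<mu> in \<open>F\<close> of the rank-one operators with vector
  \<open>T e\<^sub>\<mu>\<close> and word \<mu>. For compact \<open>T\<close> these compositions
  converge to \<open>T\<close> in norm along \<open>short_words n\<close>.\<close>

lemma compact_subset_subalgebra: "compact_ops n \<subseteq> H"
proof
  fix T assume T: "T \<in> compact_ops n"
  note Tb = compact_bounded[OF T]
  have fin: "(\<lambda>f\<in>fock n. T (ftruncate F f)) \<in> H" if "finite F" "F \<subseteq> fwords n" for F
    using that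
  proof (induction F rule: finite_induct)
    case empty
    have "(\<lambda>f\<in>fock n. T (ftruncate {} f)) = (\<lambda>f\<in>fock n. (\<lambda>\<mu>. 0))"
      by (simp add: ftruncate_def bop_zero[OF Tb])
    then show ?case
      using subalgebra_closed(2)[OF H] by (simp add: restrict_def)
  next
    case (insert \<mu> F)
    then have \<mu>: "fbasis \<mu> \<in> fock n"
      by (simp add: fock_basis)
    have "T (ftruncate (insert \<mu> F) f) = (\<lambda>\<kappa>. T (ftruncate F f) \<kappa> + f \<mu> * T (fbasis \<mu>) \<kappa>)" if f: "f \<in> fock n" for f
    proof -
      have "ftruncate (insert \<mu> F) f = (\<lambda>\<nu>. ftruncate F f \<nu> + f \<mu> * fbasis \<mu> \<nu>)"
        using insert.hyps by (auto simp: ftruncate_def fbasis_def)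
      then show ?thesis
        by (simp add: bop_add[OF Tb] bop_scale[OF Tb] fock_ftruncate(1)[OF f] fock_scale \<mu>)
    qed
    then have eq: "(\<lambda>f\<in>fock n. T (ftruncate (insert \<mu> F) f))
        = (\<lambda>f\<in>fock n. (\<lambda>\<kappa>. (\<lambda>f\<in>fock n. T (ftruncate F f)) f \<kappa> + rank_one n (T (fbasis \<mu>)) \<mu> f \<kappa>))"
      by (intro restrict_ext) (simp add: rank_one_def)
    have "(\<lambda>f\<in>fock n. T (ftruncate F f)) \<in> H"
      using insert.prems by (intro insert.IH) auto
    then show ?case
      unfolding eq
      by (rule subalgebra_closed(3)[OF H _ rank_one_in_subalgebra[OF bop_closed[OF Tb \<mu>]]])
        (use insert.prems in simp)
  qed
  show "T \<in> H"
  proof (rule subalgebra_limit[OF H _ Tb])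
    show "(\<lambda>f\<in>fock n. T (ftruncate (short_words n k) f)) \<in> H" for k
      using fin[OF finite_short_words[of n k]] by (auto simp: short_words_def)
    show "(\<lambda>k. op_norm n (\<lambda>f\<in>fock n. (\<lambda>\<mu>. (\<lambda>f\<in>fock n. T (ftruncate (short_words n k) f)) f \<mu> - T f \<mu>))) \<longlonglongrightarrow> 0"
      using compact_ftruncate_tendsto[OF T] by (simp cong: restrict_cong)
  qed
qed

lemma ring_subalgebra: "ring ((op_algebra n)\<lparr>carrier := H\<rparr>)"
proof (rule ring.subring_is_ring[OF ring_op_algebra ring.subringI[OF ring_op_algebra]])
  fix T assume T: "T \<in> H"
  then have "\<ominus>\<^bsub>op_algebra n\<^esub> T = (\<lambda>f\<in>fock n. (\<lambda>\<mu>. - T f \<mu>))"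
    using op_minus(1)[where n=n and H="bounded_ops n" and T=T and S=T] ring_op_algebra subalgebra_closed(1)[OF H]
    by (auto simp: op_algebra_self)
  then show "\<ominus>\<^bsub>op_algebra n\<^esub> T \<in> H"
    using subalgebra_closed(5)[OF H T, of "-1"] by simp
qed (use subalgebra_closed[OF H] one_in_subalgebra in auto)

lemma essential_compact_ops: "essential_ideal (compact_ops n) ((op_algebra n)\<lparr>carrier := H\<rparr>)"
  unfolding essential_ideal_def closed_ideal_def
proof (intro conjI allI impI)
  note HB = subalgebra_closed(1)[OF H]
  show "ideal (compact_ops n) ((op_algebra n)\<lparr>carrier := H\<rparr>)"
    by (rule ideal_compact_ops[OF ring_subalgebra HB compact_subset_subalgebra])
  show "norm_closed (compact_ops n) ((op_algebra n)\<lparr>carrier := H\<rparr>)"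
    by (rule norm_closed_compact_ops[OF ring_subalgebra HB compact_subset_subalgebra])
  fix J assume "(ideal J ((op_algebra n)\<lparr>carrier := H\<rparr>) \<and> norm_closed J ((op_algebra n)\<lparr>carrier := H\<rparr>))
    \<and> J \<noteq> {\<zero>\<^bsub>(op_algebra n)\<lparr>carrier := H\<rparr>\<^esub>}"
  then have J: "ideal J ((op_algebra n)\<lparr>carrier := H\<rparr>)"
    and J0: "J \<noteq> {\<zero>\<^bsub>(op_algebra n)\<lparr>carrier := H\<rparr>\<^esub>}"
    by auto
  interpret J: ideal J "(op_algebra n)\<lparr>carrier := H\<rparr>"
    by (rule J)
  obtain T where T: "T \<in> J" "T \<noteq> (\<lambda>f\<in>fock n. (\<lambda>\<mu>. 0))"
    using J0 additive_subgroup.zero_closed[OF ideal.axioms(1)[OF J]] by auto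
  have Tb: "T \<in> bounded_ops n"
    using J.Icarr[OF T(1)] HB by auto
  obtain f where f: "f \<in> fock n" "T f \<noteq> (\<lambda>\<mu>. 0)"
    using bop_eqI[OF Tb bop_zero_op] T(2) by auto
  then obtain \<mu> where \<mu>: "T f \<mu> \<noteq> 0"
    by auto
  then have w: "\<mu> \<in> fwords n"
    using fock_support[OF bop_closed[OF Tb f(1)]] by blast
  let ?E = "rank_one n (fbasis \<mu>) \<mu>"
  let ?ET = "compose (fock n) ?E T"
  have "?ET \<in> J"
    using J.I_l_closed[OF T(1), of ?E] matrix_unit_in_subalgebra[OF w w] by simp
  moreover have "?ET \<in> compact_ops n"
    by (rule compact_compose_right[OF compact_rank_one[OF fock_basis[OF w]] Tb])
  moreover have "?ET f \<mu> \<noteq> 0"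
    using \<mu> f bop_closed[OF Tb f(1)] by (simp add: compose_eq rank_one_def fbasis_def)
  then have "?ET \<noteq> (\<lambda>f\<in>fock n. (\<lambda>\<mu>. 0))"
    using f(1) by (metis restrict_apply')
  ultimately show "compact_ops n \<inter> J \<noteq> {\<zero>\<^bsub>(op_algebra n)\<lparr>carrier := H\<rparr>\<^esub>}"
    by auto
qed

end

section \<open>The extension\<close>

text \<open>The carrier being a subalgebra makes the intersected family nonempty; the intersection
  of the empty family would be the whole type instead of a subset of the carrier.\<close>

lemma cstar_subalgebra_generated:
  assumes "cstar_subalgebra (carrier A) A" "G \<subseteq> carrier A"
  shows "cstar_subalgebra (cstar_generated A G) A" and "G \<subseteq> cstar_generated A G"
proof -
  show "G \<subseteq> cstar_generated A G"
    by (auto simp: cstar_generated_def)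
  let ?X = "{H. cstar_subalgebra H A \<and> G \<subseteq> H}"
  have "carrier A \<in> ?X"
    using assms by simp
  then have "\<Inter>?X \<subseteq> carrier A"
    by (rule Inter_lower)
  moreover have "norm_closed (\<Inter>?X) A"
    unfolding norm_closed_def
  proof (intro allI ballI impI InterI)
    fix s x H
    assume x: "x \<in> carrier A"
      and s: "(\<forall>k::nat. s k \<in> \<Inter>?X) \<and> (\<lambda>k. nrm A (s k \<ominus>\<^bsub>A\<^esub> x)) \<longlonglongrightarrow> 0"
      and H: "H \<in> ?X"
    then have "norm_closed H A" "\<forall>k. s k \<in> H"
      by (auto simp: cstar_subalgebra_def)
    then show "x \<in> H"
      using x s unfolding norm_closed_def by blast
  qed
  ultimately show "cstar_subalgebra (cstar_generated A G) A"
    unfolding cstar_generated_def cstar_subalgebra_def[of "\<Inter>?X"]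
    by (auto simp: cstar_subalgebra_def)
qed

lemma cstar_subalgebra_bounded_ops: "cstar_subalgebra (bounded_ops n) (op_algebra n)"
  by (auto simp: cstar_subalgebra_def norm_closed_def bop_zero_op bop_plus bop_compose bop_smult op_adj(1))

text \<open>The isometry provided by the symbol is a witness for the definite description behind
  \<open>odometer\<close>, which therefore denotes it.\<close>

lemma odometer_bounded:
  assumes "isometric_scalar_symbol n \<xi>"
  shows "odometer n \<xi> \<in> bounded_ops n"
proof -
  obtain V where "V \<in> bounded_ops n" "\<forall>\<mu>\<in>fwords n. V (fbasis \<mu>) = odometer_value n \<xi> \<mu>"
    using assms by (auto simp: isometric_scalar_symbol_def)
  then have "odometer n \<xi> = V"
    unfolding odometer_def by (intro op_on_basis_eqI) auto
  then show ?thesis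
    using \<open>V \<in> bounded_ops n\<close> by simp
qed

text \<open>Scalar multiplication and involution of the quotient are unions over all
  representatives. Any two representatives differ by a compact operator, so every member of the
  union is the same coset and the nonempty union collapses to it; for the involution this uses that
  adjoints of compact operators are compact.\<close>

lemma star_hom_calkin_map:
  assumes H: "cstar_subalgebra H (op_algebra n)"
  shows "star_hom ((op_algebra n)\<lparr>carrier := H\<rparr>) ((calkin_algebra n)\<lparr>carrier := calkin_map n ` H\<rparr>) (calkin_map n)"
proof -
  have "ideal (compact_ops n) ((op_algebra n)\<lparr>carrier := bounded_ops n\<rparr>)"
    by (rule ideal_compact_ops) (auto simp: op_algebra_self ring_op_algebra compact_bounded)
  then interpret ideal "compact_ops n" "op_algebra n"
    by (simp only: op_algebra_self)
  note HB = subsetD[OF subalgebra_closed(1)[OF H]]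
  have self: "T \<in> calkin_map n T" if "T \<in> bounded_ops n" for T
    unfolding calkin_map_def using a_rcos_self[of T] that by simp
  have coset: "calkin_map n S = calkin_map n T" if "S \<in> calkin_map n T" "T \<in> bounded_ops n" for S T
    using a_repr_independence[OF _ _ a_subgroup, of S T] that unfolding calkin_map_def by simp
  have memD: "\<exists>K\<in>compact_ops n. S = (\<lambda>f\<in>fock n. (\<lambda>\<mu>. K f \<mu> + T f \<mu>))"
    if "S \<in> calkin_map n T" for S T
    using that by (auto simp: calkin_map_def a_r_coset_def')
  have memI: "(\<lambda>f\<in>fock n. (\<lambda>\<mu>. K f \<mu> + T f \<mu>)) \<in> calkin_map n T" if "K \<in> compact_ops n" for K T
    using that by (auto simp: calkin_map_def a_r_coset_def')
  have "calkin_map n (\<lambda>f\<in>fock n. (\<lambda>\<mu>. c * T f \<mu>)) = (\<Union>S\<in>calkin_map n T. calkin_map n (\<lambda>f\<in>fock n. (\<lambda>\<mu>. c * S f \<mu>)))"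
    if T: "T \<in> bounded_ops n" for c T
  proof -
    have *: "calkin_map n (\<lambda>f\<in>fock n. (\<lambda>\<mu>. c * S f \<mu>)) = calkin_map n (\<lambda>f\<in>fock n. (\<lambda>\<mu>. c * T f \<mu>))"
      if ST: "S \<in> calkin_map n T" for S
    proof -
      obtain K where K: "K \<in> compact_ops n" and S: "S = (\<lambda>f\<in>fock n. (\<lambda>\<mu>. K f \<mu> + T f \<mu>))"
        using memD[OF ST] by blast
      have "(\<lambda>f\<in>fock n. (\<lambda>\<mu>. c * S f \<mu>))
          = (\<lambda>f\<in>fock n. (\<lambda>\<mu>. (\<lambda>f\<in>fock n. (\<lambda>\<mu>. c * K f \<mu>)) f \<mu> + (\<lambda>f\<in>fock n. (\<lambda>\<mu>. c * T f \<mu>)) f \<mu>))"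
        by (intro restrict_ext) (simp add: S distrib_left)
      then show ?thesis
        using memI[OF compact_smult[OF K, of c], of "\<lambda>f\<in>fock n. (\<lambda>\<mu>. c * T f \<mu>)"]
        by (intro coset bop_smult[OF T]) simp
    qed
    have "calkin_map n T \<noteq> {}"
      using self[OF T] by blast
    then show ?thesis
      by (simp only: SUP_cong[OF refl *] UN_constant if_False)
  qed
  moreover have "calkin_map n (op_adj n T) = (\<Union>S\<in>calkin_map n T. calkin_map n (op_adj n S))"
    if T: "T \<in> bounded_ops n" for T
  proof -
    have *: "calkin_map n (op_adj n S) = calkin_map n (op_adj n T)" if ST: "S \<in> calkin_map n T" for S
    proof -
      obtain K where K: "K \<in> compact_ops n" and S: "S = (\<lambda>f\<in>fock n. (\<lambda>\<mu>. K f \<mu> + T f \<mu>))"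
        using memD[OF ST] by blast
      have "op_adj n S = (\<lambda>f\<in>fock n. (\<lambda>\<mu>. op_adj n K f \<mu> + op_adj n T f \<mu>))"
        unfolding S by (rule op_adj_plus[OF compact_bounded[OF K] T])
      then show ?thesis
        using memI[OF compact_adj[OF K], of "op_adj n T"] by (intro coset op_adj(1)[OF T]) simp
    qed
    have "calkin_map n T \<noteq> {}"
      using self[OF T] by blast
    then show ?thesis
      by (simp only: SUP_cong[OF refl *] UN_constant if_False)
  qed
  moreover have "calkin_map n (S \<otimes>\<^bsub>op_algebra n\<^esub> T)
      = calkin_map n S \<otimes>\<^bsub>op_algebra n Quot compact_ops n\<^esub> calkin_map n T"
    if "S \<in> bounded_ops n" "T \<in> bounded_ops n" for S T
    using ring_hom_mult[OF rcos_ring_hom, of S T] that by (simp add: calkin_map_def)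
  moreover have "calkin_map n (S \<oplus>\<^bsub>op_algebra n\<^esub> T)
      = calkin_map n S \<oplus>\<^bsub>op_algebra n Quot compact_ops n\<^esub> calkin_map n T"
    if "S \<in> bounded_ops n" "T \<in> bounded_ops n" for S T
    using ring_hom_add[OF rcos_ring_hom, of S T] that by (simp add: calkin_map_def)
  ultimately show ?thesis
    using HB unfolding star_hom_def hom_def
    by (auto simp: calkin_algebra_def cstar_quot_def simp flip: calkin_map_def)
qed

text \<open>Each identity is checked after applying \<rho>, which is injective and a homomorphism.
  The closure assumptions on \<open>A\<close> allow the restricted function to be evaluated at
  scalar multiples and adjoints.\<close>

lemma star_hom_inv_into:
  assumes Q: "unital_cstar_algebra Q" and \<rho>: "star_iso Q B \<rho>" and h: "star_hom A B h"
    and A: "ring A" "\<And>c x. x \<in> carrier A \<Longrightarrow> c \<odot>\<^bsub>A\<^esub> x \<in> carrier A"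
      "\<And>x. x \<in> carrier A \<Longrightarrow> adj A x \<in> carrier A"
  shows "star_hom A Q (\<lambda>x\<in>carrier A. inv_into (carrier Q) \<rho> (h x))"
proof -
  interpret Q: unital_cstar_algebra Q
    by (rule Q)
  interpret A: ring A
    by (rule A(1))
  let ?g = "\<lambda>x. inv_into (carrier Q) \<rho> (h x)"
  have inj: "inj_on \<rho> (carrier Q)" and im: "\<rho> ` carrier Q = carrier B" and \<rho>h: "star_hom Q B \<rho>"
    using \<rho> by (auto simp: star_iso_def bij_betw_def)
  have hB: "h x \<in> carrier B" if "x \<in> carrier A" for x
    using h that by (auto simp: star_hom_def hom_def)
  have g: "?g x \<in> carrier Q" "\<rho> (?g x) = h x" if "x \<in> carrier A" for x
    using hB[OF that] im inv_into_into[of "h x" \<rho> "carrier Q"] f_inv_into_f[of "h x" \<rho> "carrier Q"] by auto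
  have eq: "?g x = y" if "y \<in> carrier Q" "\<rho> y = h x" for x y
    using inv_into_f_f[OF inj that(1)] that(2) by simp
  have "?g (x \<otimes>\<^bsub>A\<^esub> y) = ?g x \<otimes>\<^bsub>Q\<^esub> ?g y" "?g (x \<oplus>\<^bsub>A\<^esub> y) = ?g x \<oplus>\<^bsub>Q\<^esub> ?g y"
    if "x \<in> carrier A" "y \<in> carrier A" for x y
    using that g[OF that(1)] g[OF that(2)] h \<rho>h by (intro eq; simp add: star_hom_def hom_def)+
  moreover have "?g (c \<odot>\<^bsub>A\<^esub> x) = c \<odot>\<^bsub>Q\<^esub> ?g x" if "x \<in> carrier A" for c x
  proof (rule eq)
    show "c \<odot>\<^bsub>Q\<^esub> ?g x \<in> carrier Q"
      using g(1)[OF that] by (intro Q.smult_closed) (auto simp: ring_of_type_algebra_def)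
  qed (use that g[OF that] h \<rho>h in \<open>simp add: star_hom_def\<close>)
  moreover have "?g (adj A x) = adj Q (?g x)" if "x \<in> carrier A" for x
    using that g[OF that] h \<rho>h by (intro eq) (simp_all add: star_hom_def Q.adj_closed)
  ultimately show ?thesis
    using g(1) A(2,3) by (auto simp: star_hom_def hom_def)
qed

theorem corollary5p2:
  fixes n d :: nat and \<xi> :: fvec
    and Q :: "'q cstar" and u :: 'q and t :: "nat \<Rightarrow> 'q"
    and \<rho> :: "'q \<Rightarrow> (fvec \<Rightarrow> fvec) set"
  assumes "n \<ge> 2"
    and "finite_Blaschke_symbol n d \<xi>"
    and "is_boundary_quotient n Q u t"
    and "star_iso Q (calkin_image n \<xi>) \<rho>"
    and "\<rho> u = calkin_map n (odometer n \<xi>)"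
    and "\<forall>i\<in>{1..n}. \<rho> (t i) = calkin_map n (creation n i)"
  shows "short_exact ((op_algebra n)\<lparr>carrier := compact_ops n\<rparr>) (\<lambda>T. T)
           (odometer_algebra n \<xi>) (symbol_map n \<xi> Q \<rho>) Q
         \<and> essential_ideal (compact_ops n) (odometer_algebra n \<xi>)"
proof -
  define G where "G = creation n ` {1..n} \<union> {odometer n \<xi>}"
  define H where "H = cstar_generated (op_algebra n) G"
  have alg: "odometer_algebra n \<xi> = (op_algebra n)\<lparr>carrier := H\<rparr>"
    by (simp add: odometer_algebra_def H_def G_def)
  have "odometer n \<xi> \<in> bounded_ops n"
    using assms(2) by (simp add: finite_Blaschke_symbol_def odometer_bounded)
  then have "G \<subseteq> carrier (op_algebra n)"
    by (auto simp: G_def creation_eq bop_left_shift)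
  then have H: "cstar_subalgebra H (op_algebra n)" and "G \<subseteq> H"
    unfolding H_def using cstar_subalgebra_generated[of "op_algebra n" G] cstar_subalgebra_bounded_ops[of n]
    by simp_all
  then have gen: "creation n ` {1..n} \<subseteq> H" and n: "1 \<le> n"
    using assms(1) by (auto simp: G_def)
  note HB = subalgebra_closed(1)[OF H]
  note KH = compact_subset_subalgebra[OF H n gen]
  note RH = ring_subalgebra[OF H n gen]
  note pi = star_hom_calkin_map[OF H]
  have image: "calkin_image n \<xi> = (calkin_algebra n)\<lparr>carrier := calkin_map n ` H\<rparr>"
    by (simp add: calkin_image_def alg)
  have Q: "unital_cstar_algebra Q"
    using assms(3) by (simp add: is_boundary_quotient_def)
  interpret Q: unital_cstar_algebra Q
    by (rule Q)
  have bij: "bij_betw \<rho> (carrier Q) (calkin_map n ` H)" and \<rho>: "star_hom Q (calkin_image n \<xi>) \<rho>"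
    using assms(4) by (simp_all add: star_iso_def image)
  define \<Phi> where "\<Phi> = symbol_map n \<xi> Q \<rho>"
  have \<Phi>_eq: "\<Phi> T = inv_into (carrier Q) \<rho> (calkin_map n T)" if "T \<in> H" for T
    using that by (simp add: \<Phi>_def symbol_map_def alg)
  have hom: "star_hom (odometer_algebra n \<xi>) Q \<Phi>"
    using star_hom_inv_into[OF Q assms(4)[unfolded image] pi RH] subalgebra_closed(5,6)[OF H]
    by (simp add: \<Phi>_def symbol_map_def alg)
  have \<rho>\<Phi>: "\<rho> (\<Phi> T) = calkin_map n T" if "T \<in> H" for T
    using bij that by (simp add: \<Phi>_eq bij_betw_inv_into_right)
  \<comment> \<open>The target of \<rho> is by definition the Calkin image of the algebra, so its
    inverse carries that image onto all of \<open>Q\<close>.\<close>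
  have surj: "\<Phi> ` H = carrier Q"
  proof -
    have "inv_into (carrier Q) \<rho> ` calkin_map n ` H = carrier Q"
      using bij_betw_inv_into[OF bij] by (simp add: bij_betw_def)
    then show ?thesis
      by (simp add: \<Phi>_eq image_image cong: image_cong)
  qed
  have "ideal (compact_ops n) ((op_algebra n)\<lparr>carrier := bounded_ops n\<rparr>)"
    by (rule ideal_compact_ops) (auto simp: op_algebra_self ring_op_algebra compact_bounded)
  then have K: "ideal (compact_ops n) (op_algebra n)"
    by (simp only: op_algebra_self)
  have coset: "calkin_map n T = compact_ops n \<longleftrightarrow> T \<in> compact_ops n" if "T \<in> H" for T
    using ideal.rcos_const_imp_mem[OF K, of T] ring.a_rcos_zero[OF ring_op_algebra K, of T] that HB
    by (auto simp: calkin_map_def)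
  have zero: "(\<lambda>f\<in>fock n. (\<lambda>\<mu>. 0)) \<in> H"
    by (rule subalgebra_closed(2)[OF H])
  \<comment> \<open>Preservation of zero is not a clause of \<open>star_hom\<close>; it follows from
    additivity, since the image of zero equals its own double and can be cancelled.\<close>
  have \<Phi>0: "\<Phi> (\<lambda>f\<in>fock n. (\<lambda>\<mu>. 0)) = \<zero>\<^bsub>Q\<^esub>"
  proof -
    let ?z = "\<lambda>f\<in>fock n. (\<lambda>\<mu>. 0::complex)"
    have zz: "(\<lambda>f\<in>fock n. (\<lambda>\<mu>. ?z f \<mu> + ?z f \<mu>)) = ?z"
      by (intro restrict_ext) simp
    have "\<Phi> (\<lambda>f\<in>fock n. (\<lambda>\<mu>. S f \<mu> + T f \<mu>)) = \<Phi> S \<oplus>\<^bsub>Q\<^esub> \<Phi> T" if "S \<in> H" "T \<in> H" for S T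
      using hom that by (auto simp: star_hom_def hom_def alg)
    from this[OF zero zero] have "\<Phi> ?z = \<Phi> ?z \<oplus>\<^bsub>Q\<^esub> \<Phi> ?z"
      by (simp only: zz)
    moreover have "\<Phi> ?z \<in> carrier Q"
      using surj zero by auto
    ultimately show ?thesis
      by (metis Q.add.l_cancel_one)
  qed
  have kernel: "\<Phi> T = \<zero>\<^bsub>Q\<^esub> \<longleftrightarrow> T \<in> compact_ops n" if T: "T \<in> H" for T
  proof -
    \<comment> \<open>Applying \<rho> gives one direction and applying its inverse the other, with
      zero written as the image of the zero operator.\<close>
    have "\<Phi> T = \<zero>\<^bsub>Q\<^esub> \<longleftrightarrow> calkin_map n T = calkin_map n (\<lambda>f\<in>fock n. (\<lambda>\<mu>. 0))"
      using \<rho>\<Phi>[OF T] \<rho>\<Phi>[OF zero] \<Phi>0 \<Phi>_eq[OF T] \<Phi>_eq[OF zero] by auto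
    also have "\<dots> \<longleftrightarrow> T \<in> compact_ops n"
      using coset[OF T] coset[OF zero] compact_zero by simp
    finally show ?thesis .
  qed
  have "star_hom ((op_algebra n)\<lparr>carrier := compact_ops n\<rparr>) (odometer_algebra n \<xi>) (\<lambda>T. T)"
    using KH by (auto simp: star_hom_def hom_def alg)
  then have "short_exact ((op_algebra n)\<lparr>carrier := compact_ops n\<rparr>) (\<lambda>T. T)
           (odometer_algebra n \<xi>) \<Phi> Q"
    using hom surj kernel KH by (auto simp: short_exact_def alg)
  moreover have "essential_ideal (compact_ops n) (odometer_algebra n \<xi>)"
    unfolding alg by (rule essential_compact_ops[OF H n gen])
  ultimately show ?thesis
    by (simp add: \<Phi>_def)
qed

end
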